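(* Let $V$ be a superspace of dimension $n|m$, and let $T^{ab}=-T^{ba}$ (even), $\theta^{a\lambda}$ (odd) and $S^{\lambda\mu}=S^{\mu\lambda}$ (even), where $a,b=1,\dots,n$ and $\lambda,\mu=1,\dots,m$, be the components of an even bivector $T\in\Lambda^2(V)$, where it is assumed that at least one even component is invertible. Consider the super Plücker relations for these components, $$\begin{aligned} T^{ab}T^{cd}&=T^{ac}T^{bd}+T^{ad}T^{cb},\\ T^{ab}\theta^{c\mu}&=T^{ac}\theta^{b\mu}+T^{cb}\theta^{a\mu},\\ T^{ab}S^{\lambda\mu}&=-\theta^{a\lambda}\theta^{b\mu}-\theta^{a\mu}\theta^{b\lambda},\\ \theta^{a\nu}S^{\lambda\mu}&=-\theta^{a\lambda}S^{\mu\nu}-\theta^{a\mu}S^{\lambda\nu},\\ S^{\kappa\nu}S^{\lambda\mu}&=-S^{\kappa\lambda}S^{\mu\nu}-S^{\kappa\mu}S^{\lambda\nu} \end{aligned}$$ for all $a,b,c,d\in\{1,\dots,n\}$ and $\kappa,\lambda,\mu,\nu\in\{1,\dots,m\}$. (1) These relations imply that all the variables $S^{\lambda\mu}$ are nilpotent, and hence that at least one of the variables $T^{ab}$ is invertible (i.e. that the bivector $T$ is non-degenerate). (2) The algebra generated by $T^{ab}$, $\theta^{a\lambda}$ and $S^{\lambda\mu}$ (subject to the super Plücker relations above) is isomorphic to the algebra generated by $T^{ab}$, $\theta^{a\lambda}$ alone subject to the relations $$T^{ab}T^{cd}=T^{ac}T^{bd}+T^{ad}T^{cb},\qquad T^{ab}\theta^{c\mu}=T^{ac}\theta^{b\mu}+T^{cb}\theta^{a\mu}$$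 (the "reduced super Plücker relations").
   Context: Let $e_1,\dots,e_n$ be the even and $\varepsilon_1,\dots,\varepsilon_m$ the odd vectors of a basis of $V$. The components of an even bivector $T\in\Lambda^2(V)$, where $\Lambda(V)$ is the exterior algebra defined by $v\wedge w=-(-1)^{\tilde v\tilde w}w\wedge v$ (tilde denotes parity), are defined by $$T=2\sum_{a<b}T^{ab}e_a\wedge e_b+2\sum_{a,\mu}\theta^{a\mu}e_a\wedge\varepsilon_\mu+\sum_\lambda S^{\lambda\lambda}\varepsilon_\lambda\wedge\varepsilon_\lambda+2\sum_{\lambda<\mu}S^{\lambda\mu}\varepsilon_\lambda\wedge\varepsilon_\mu ,$$ with $T^{ab},S^{\lambda\mu}$ even and $\theta^{a\mu}$ odd (coefficients are allowed in a commutative superalgebra). The even components are the $T^{ab}$ and the $S^{\lambda\mu}$. The bivector $T$ is called non-degenerate if at least one of the components $T^{ab}$, $a,b=1,\dots,n$ (all indices even), is invertible. The listed super Plücker relations, together with non-degeneracy, are the conditions for $T$ to be simple, i.e. $T=u_1\wedge u_2$ for independent even vectors $u_1,u_2$. *)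

theory Defs
  imports "HOL-Algebra.QuotRing" "HOL-Algebra.Module" "HOL-Library.Poly_Mapping"
begin

definition scalars :: "'k::field ring" where
  "scalars = \<lparr>carrier = UNIV, mult = (*), one = 1, zero = 0, add = (+)\<rparr>"

record ('k, 'a) superalgebra = "('k, 'a) module" +
  even_part :: "'a set"
  odd_part :: "'a set"

locale comm_superalgebra = ring A
  for A :: "('k::field_char_0, 'a) superalgebra" (structure) +
  assumes module: "module scalars A"
    and smult_mult_left:
      "\<lbrakk>x \<in> carrier A; y \<in> carrier A\<rbrakk> \<Longrightarrow> (c \<odot> x) \<otimes> y = c \<odot> (x \<otimes> y)"
    and smult_mult_right:
      "\<lbrakk>x \<in> carrier A; y \<in> carrier A\<rbrakk> \<Longrightarrow> x \<otimes> (c \<odot> y) = c \<odot> (x \<otimes> y)"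
    and even_submodule: "submodule (even_part A) scalars A"
    and odd_submodule: "submodule (odd_part A) scalars A"
    and grading:
      "x \<in> carrier A \<Longrightarrow> \<exists>!(e, d). e \<in> even_part A \<and> d \<in> odd_part A \<and> x = e \<oplus> d"
    and one_even: "\<one> \<in> even_part A"
    and even_even: "\<lbrakk>x \<in> even_part A; y \<in> even_part A\<rbrakk> \<Longrightarrow> x \<otimes> y \<in> even_part A"
    and even_odd: "\<lbrakk>x \<in> even_part A; y \<in> odd_part A\<rbrakk> \<Longrightarrow> x \<otimes> y \<in> odd_part A"
    and odd_even: "\<lbrakk>x \<in> odd_part A; y \<in> even_part A\<rbrakk> \<Longrightarrow> x \<otimes> y \<in> odd_part A"
    and odd_odd: "\<lbrakk>x \<in> odd_part A; y \<in> odd_part A\<rbrakk> \<Longrightarrow> x \<otimes> y \<in> even_part A"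
    and even_commute: "\<lbrakk>x \<in> even_part A; y \<in> carrier A\<rbrakk> \<Longrightarrow> x \<otimes> y = y \<otimes> x"
    and odd_anticommute: "\<lbrakk>x \<in> odd_part A; y \<in> odd_part A\<rbrakk> \<Longrightarrow> x \<otimes> y = \<ominus> (y \<otimes> x)"

definition nilpotent :: "('a, 'b) ring_scheme \<Rightarrow> 'a \<Rightarrow> bool" where
  "nilpotent R x \<longleftrightarrow> (\<exists>k::nat. x [^]\<^bsub>R\<^esub> k = \<zero>\<^bsub>R\<^esub>)"

definition superalgebra_iso ::
  "('k, 'a) superalgebra \<Rightarrow> ('k, 'b) superalgebra \<Rightarrow> ('a \<Rightarrow> 'b) set" where
  "superalgebra_iso A B = {h \<in> ring_iso A B.
     (\<forall>c. \<forall>x\<in>carrier A. h (c \<odot>\<^bsub>A\<^esub> x) = c \<odot>\<^bsub>B\<^esub> h x) \<and>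
     h ` even_part A = even_part B \<and> h ` odd_part A = odd_part B}"

text \<open>
  A relation is represented by the pair of its two sides, so that the same system of relations
  can be imposed on elements of a given superalgebra and used to present a superalgebra.
\<close>

definition satisfied :: "('a \<times> 'a) set \<Rightarrow> bool" where
  "satisfied E \<longleftrightarrow> (\<forall>(l, r)\<in>E. l = r)"

definition T_symmetry ::
  "('a, 'b) ring_scheme \<Rightarrow> nat \<Rightarrow> (nat \<Rightarrow> nat \<Rightarrow> 'a) \<Rightarrow> ('a \<times> 'a) set" where
  "T_symmetry R n T = {(T a b, \<ominus>\<^bsub>R\<^esub> T b a) | a b. a \<in> {1..n} \<and> b \<in> {1..n}}"

definition S_symmetry :: "nat \<Rightarrow> (nat \<Rightarrow> nat \<Rightarrow> 'a) \<Rightarrow> ('a \<times> 'a) set" where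
  "S_symmetry m S = {(S l k, S k l) | k l. k \<in> {1..m} \<and> l \<in> {1..m}}"

definition reduced_super_plucker ::
  "('a, 'b) ring_scheme \<Rightarrow> nat \<Rightarrow> nat \<Rightarrow> (nat \<Rightarrow> nat \<Rightarrow> 'a) \<Rightarrow> (nat \<Rightarrow> nat \<Rightarrow> 'a) \<Rightarrow> ('a \<times> 'a) set"
where
  "reduced_super_plucker R n m T \<theta> =
     {(T a b \<otimes>\<^bsub>R\<^esub> T c d, (T a c \<otimes>\<^bsub>R\<^esub> T b d) \<oplus>\<^bsub>R\<^esub> (T a d \<otimes>\<^bsub>R\<^esub> T c b)) | a b c d.
        a \<in> {1..n} \<and> b \<in> {1..n} \<and> c \<in> {1..n} \<and> d \<in> {1..n}} \<union>
     {(T a b \<otimes>\<^bsub>R\<^esub> \<theta> c \<mu>, (T a c \<otimes>\<^bsub>R\<^esub> \<theta> b \<mu>) \<oplus>\<^bsub>R\<^esub> (T c b \<otimes>\<^bsub>R\<^esub> \<theta> a \<mu>)) | a b c \<mu>.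
        a \<in> {1..n} \<and> b \<in> {1..n} \<and> c \<in> {1..n} \<and> \<mu> \<in> {1..m}}"

definition super_plucker ::
  "('a, 'b) ring_scheme \<Rightarrow> nat \<Rightarrow> nat \<Rightarrow> (nat \<Rightarrow> nat \<Rightarrow> 'a) \<Rightarrow> (nat \<Rightarrow> nat \<Rightarrow> 'a) \<Rightarrow>
    (nat \<Rightarrow> nat \<Rightarrow> 'a) \<Rightarrow> ('a \<times> 'a) set"
where
  "super_plucker R n m T \<theta> S = reduced_super_plucker R n m T \<theta> \<union>
     {(T a b \<otimes>\<^bsub>R\<^esub> S l \<mu>,
       (\<ominus>\<^bsub>R\<^esub> (\<theta> a l \<otimes>\<^bsub>R\<^esub> \<theta> b \<mu>)) \<ominus>\<^bsub>R\<^esub> (\<theta> a \<mu> \<otimes>\<^bsub>R\<^esub> \<theta> b l)) | a b l \<mu>.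
        a \<in> {1..n} \<and> b \<in> {1..n} \<and> l \<in> {1..m} \<and> \<mu> \<in> {1..m}} \<union>
     {(\<theta> a \<nu> \<otimes>\<^bsub>R\<^esub> S l \<mu>,
       (\<ominus>\<^bsub>R\<^esub> (\<theta> a l \<otimes>\<^bsub>R\<^esub> S \<mu> \<nu>)) \<ominus>\<^bsub>R\<^esub> (\<theta> a \<mu> \<otimes>\<^bsub>R\<^esub> S l \<nu>)) | a \<nu> l \<mu>.
        a \<in> {1..n} \<and> \<nu> \<in> {1..m} \<and> l \<in> {1..m} \<and> \<mu> \<in> {1..m}} \<union>
     {(S \<kappa> \<nu> \<otimes>\<^bsub>R\<^esub> S l \<mu>,
       (\<ominus>\<^bsub>R\<^esub> (S \<kappa> l \<otimes>\<^bsub>R\<^esub> S \<mu> \<nu>)) \<ominus>\<^bsub>R\<^esub> (S \<kappa> \<mu> \<otimes>\<^bsub>R\<^esub> S l \<nu>)) | \<kappa> \<nu> l \<mu>.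
        \<kappa> \<in> {1..m} \<and> \<nu> \<in> {1..m} \<and> l \<in> {1..m} \<and> \<mu> \<in> {1..m}}"

text \<open>
  An even bivector with coefficients in \<open>A\<close>, on a superspace of dimension \<open>n|m\<close> with basis
  \<open>e\<^sub>1, \<dots>, e\<^sub>n, \<epsilon>\<^sub>1, \<dots>, \<epsilon>\<^sub>m\<close>, is given by its components: the coefficients of \<open>2 e\<^sub>a \<and> e\<^sub>b\<close> and
  \<open>2 \<epsilon>\<^sub>\<lambda> \<and> \<epsilon>\<^sub>\<mu>\<close> for smaller first index, of \<open>2 e\<^sub>a \<and> \<epsilon>\<^sub>\<mu>\<close>, and of \<open>\<epsilon>\<^sub>\<lambda> \<and> \<epsilon>\<^sub>\<lambda>\<close>, extended to all pairs
  of indices by the symmetries.  They can be arbitrary elements of the indicated parity.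
\<close>

definition even_bivector_components ::
  "('k, 'a) superalgebra \<Rightarrow> nat \<Rightarrow> nat \<Rightarrow> (nat \<Rightarrow> nat \<Rightarrow> 'a) \<Rightarrow> (nat \<Rightarrow> nat \<Rightarrow> 'a) \<Rightarrow>
    (nat \<Rightarrow> nat \<Rightarrow> 'a) \<Rightarrow> bool"
where
  "even_bivector_components A n m T \<theta> S \<longleftrightarrow>
     (\<forall>a\<in>{1..n}. \<forall>b\<in>{1..n}. T a b \<in> even_part A) \<and>
     (\<forall>a\<in>{1..n}. \<forall>\<mu>\<in>{1..m}. \<theta> a \<mu> \<in> odd_part A) \<and>
     (\<forall>l\<in>{1..m}. \<forall>\<mu>\<in>{1..m}. S l \<mu> \<in> even_part A) \<and>
     satisfied (T_symmetry A n T) \<and> satisfied (S_symmetry m S)"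

definition nondegenerate :: "('a, 'b) ring_scheme \<Rightarrow> nat \<Rightarrow> (nat \<Rightarrow> nat \<Rightarrow> 'a) \<Rightarrow> bool" where
  "nondegenerate R n T \<longleftrightarrow> (\<exists>a\<in>{1..n}. \<exists>b\<in>{1..n}. T a b \<in> Units R)"

definition some_even_component_invertible ::
  "('a, 'b) ring_scheme \<Rightarrow> nat \<Rightarrow> nat \<Rightarrow> (nat \<Rightarrow> nat \<Rightarrow> 'a) \<Rightarrow> (nat \<Rightarrow> nat \<Rightarrow> 'a) \<Rightarrow> bool"
where
  "some_even_component_invertible R n m T S \<longleftrightarrow>
     (\<exists>a\<in>{1..n}. \<exists>b\<in>{1..n}. T a b \<in> Units R) \<or> (\<exists>l\<in>{1..m}. \<exists>\<mu>\<in>{1..m}. S l \<mu> \<in> Units R)"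

datatype 'g free_monoid = Word (letters: "'g list")

instantiation free_monoid :: (type) monoid_add
begin

definition zero_free_monoid :: "'a free_monoid" where
  "0 = Word []"

definition plus_free_monoid :: "'a free_monoid \<Rightarrow> 'a free_monoid \<Rightarrow> 'a free_monoid" where
  "v + w = Word (letters v @ letters w)"

instance
  by standard (simp_all add: zero_free_monoid_def plus_free_monoid_def)

end

text \<open>
  Finitely supported functions on words, with the convolution product, form the free associative
  algebra; the multiplication of words is the addition of the key type.
\<close>

type_synonym ('g, 'k) free_algebra = "'g free_monoid \<Rightarrow>\<^sub>0 'k"

definition const :: "'k::field \<Rightarrow> ('g, 'k) free_algebra" where
  "const c = Poly_Mapping.single 0 c"

definition gen :: "'g \<Rightarrow> ('g, 'k::field) free_algebra" where
  "gen x = Poly_Mapping.single (Word [x]) 1"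

definition word_odd :: "('g \<Rightarrow> bool) \<Rightarrow> 'g free_monoid \<Rightarrow> bool" where
  "word_odd p w \<longleftrightarrow> odd (length (filter p (letters w)))"

text \<open>The free associative superalgebra on \<open>X\<close>; the predicate \<open>p\<close> singles out the odd generators.\<close>

definition free_superalgebra ::
  "'g set \<Rightarrow> ('g \<Rightarrow> bool) \<Rightarrow> ('k::field, ('g, 'k) free_algebra) superalgebra" where
  "free_superalgebra X p =
     (let F = {f. \<forall>w\<in>Poly_Mapping.keys f. set (letters w) \<subseteq> X} in
      \<lparr>carrier = F, mult = (*), one = 1, zero = 0, add = (+),
       smult = (\<lambda>c f. const c * f),
       even_part = {f \<in> F. \<forall>w\<in>Poly_Mapping.keys f. \<not> word_odd p w},
       odd_part = {f \<in> F. \<forall>w\<in>Poly_Mapping.keys f. word_odd p w}\<rparr>)"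

definition relation_ideal :: "('a, 'b) ring_scheme \<Rightarrow> ('a \<times> 'a) set \<Rightarrow> 'a set" where
  "relation_ideal R E = Idl\<^bsub>R\<^esub> {l \<ominus>\<^bsub>R\<^esub> r | l r. (l, r) \<in> E}"

definition quotient_superalgebra ::
  "('k, 'a) superalgebra \<Rightarrow> ('a \<times> 'a) set \<Rightarrow> ('k, 'a set) superalgebra" where
  "quotient_superalgebra A E =
     (let I = relation_ideal A E; Q = A Quot I in
      \<lparr>carrier = carrier Q, mult = mult Q, one = one Q, zero = zero Q, add = add Q,
       smult = (\<lambda>c C. (I +>\<^bsub>A\<^esub> (c \<odot>\<^bsub>A\<^esub> \<one>\<^bsub>A\<^esub>)) \<otimes>\<^bsub>Q\<^esub> C),
       even_part = (\<lambda>x. I +>\<^bsub>A\<^esub> x) ` even_part A,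
       odd_part = (\<lambda>x. I +>\<^bsub>A\<^esub> x) ` odd_part A\<rparr>)"

text \<open>For \<open>x = y\<close> odd this gives \<open>x\<^sup>2 = - x\<^sup>2\<close>, hence \<open>x\<^sup>2 = 0\<close> away from characteristic 2.\<close>

definition supercommutation ::
  "'g set \<Rightarrow> ('g \<Rightarrow> bool) \<Rightarrow> (('g, 'k::field) free_algebra \<times> ('g, 'k) free_algebra) set" where
  "supercommutation X p =
     {(gen x * gen y, (if p x \<and> p y then - 1 else 1) * (gen y * gen x)) | x y. x \<in> X \<and> y \<in> X}"

datatype generator = TG nat nat | ThetaG nat nat | SG nat nat | TinvG nat nat

fun odd_generator :: "generator \<Rightarrow> bool" where
  "odd_generator (ThetaG a \<mu>) = True"
| "odd_generator _ = False"

text \<open>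
  Invertibility of an even component (as a consequence of the relations, of some \<open>T\<^sup>a\<^sup>b\<close>) becomes a
  localization: an inverse \<open>TinvG a b\<close> of \<open>TG a b\<close> is adjoined for all \<open>(a, b)\<close> in a set \<open>D\<close>, to be
  nonempty.  With \<open>D\<close> empty the full and the reduced algebra differ, as no \<open>SG l \<mu>\<close> is then a
  polynomial in the other generators.
\<close>

definition reduced_generators :: "nat \<Rightarrow> nat \<Rightarrow> (nat \<times> nat) set \<Rightarrow> generator set" where
  "reduced_generators n m D =
     {TG a b | a b. a \<in> {1..n} \<and> b \<in> {1..n}} \<union>
     {ThetaG a \<mu> | a \<mu>. a \<in> {1..n} \<and> \<mu> \<in> {1..m}} \<union>
     {TinvG a b | a b. (a, b) \<in> D}"

definition full_generators :: "nat \<Rightarrow> nat \<Rightarrow> (nat \<times> nat) set \<Rightarrow> generator set" where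
  "full_generators n m D =
     reduced_generators n m D \<union> {SG l \<mu> | l \<mu>. l \<in> {1..m} \<and> \<mu> \<in> {1..m}}"

definition T_gen :: "nat \<Rightarrow> nat \<Rightarrow> (generator, 'k::field) free_algebra" where
  "T_gen a b = gen (TG a b)"

definition Theta_gen :: "nat \<Rightarrow> nat \<Rightarrow> (generator, 'k::field) free_algebra" where
  "Theta_gen a \<mu> = gen (ThetaG a \<mu>)"

definition S_gen :: "nat \<Rightarrow> nat \<Rightarrow> (generator, 'k::field) free_algebra" where
  "S_gen l \<mu> = gen (SG l \<mu>)"

definition inversion ::
  "(nat \<times> nat) set \<Rightarrow> ((generator, 'k::field) free_algebra \<times> (generator, 'k) free_algebra) set"
where
  "inversion D = {(gen (TG a b) * gen (TinvG a b), 1) | a b. (a, b) \<in> D}"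

abbreviation full_free ::
  "nat \<Rightarrow> nat \<Rightarrow> (nat \<times> nat) set \<Rightarrow> ('k::field, (generator, 'k) free_algebra) superalgebra" where
  "full_free n m D \<equiv> free_superalgebra (full_generators n m D) odd_generator"

abbreviation reduced_free ::
  "nat \<Rightarrow> nat \<Rightarrow> (nat \<times> nat) set \<Rightarrow> ('k::field, (generator, 'k) free_algebra) superalgebra" where
  "reduced_free n m D \<equiv> free_superalgebra (reduced_generators n m D) odd_generator"

definition full_relations ::
  "nat \<Rightarrow> nat \<Rightarrow> (nat \<times> nat) set \<Rightarrow>
    ((generator, 'k::field) free_algebra \<times> (generator, 'k) free_algebra) set"
where
  "full_relations n m D =
     supercommutation (full_generators n m D) odd_generator \<union>
     T_symmetry (full_free n m D) n T_gen \<union> S_symmetry m S_gen \<union>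
     super_plucker (full_free n m D) n m T_gen Theta_gen S_gen \<union>
     inversion D"

definition reduced_relations ::
  "nat \<Rightarrow> nat \<Rightarrow> (nat \<times> nat) set \<Rightarrow>
    ((generator, 'k::field) free_algebra \<times> (generator, 'k) free_algebra) set"
where
  "reduced_relations n m D =
     supercommutation (reduced_generators n m D) odd_generator \<union>
     T_symmetry (reduced_free n m D) n T_gen \<union>
     reduced_super_plucker (reduced_free n m D) n m T_gen Theta_gen \<union>
     inversion D"

definition full_algebra ::
  "nat \<Rightarrow> nat \<Rightarrow> (nat \<times> nat) set \<Rightarrow> ('k::field, (generator, 'k) free_algebra set) superalgebra" where
  "full_algebra n m D = quotient_superalgebra (full_free n m D) (full_relations n m D)"

definition reduced_algebra ::
  "nat \<Rightarrow> nat \<Rightarrow> (nat \<times> nat) set \<Rightarrow> ('k::field, (generator, 'k) free_algebra set) superalgebra" where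
  "reduced_algebra n m D = quotient_superalgebra (reduced_free n m D) (reduced_relations n m D)"

definition full_class ::
  "nat \<Rightarrow> nat \<Rightarrow> (nat \<times> nat) set \<Rightarrow> (generator, 'k::field) free_algebra \<Rightarrow>
    (generator, 'k) free_algebra set" where
  "full_class n m D f =
     relation_ideal (full_free n m D) (full_relations n m D) +>\<^bsub>full_free n m D\<^esub> f"

definition reduced_class ::
  "nat \<Rightarrow> nat \<Rightarrow> (nat \<times> nat) set \<Rightarrow> (generator, 'k::field) free_algebra \<Rightarrow>
    (generator, 'k) free_algebra set" where
  "reduced_class n m D f =
     relation_ideal (reduced_free n m D) (reduced_relations n m D) +>\<^bsub>reduced_free n m D\<^esub> f"

end

theory Submission
  imports Defs
begin

text \<open>
  Equal indices in the last relation give \<open>3 (S\<^sup>\<lambda>\<^sup>\<lambda>)\<^sup>2 = 0\<close>, and pairing \<open>\<lambda>, \<mu>\<close> with themselves gives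
  \<open>2 (S\<^sup>\<lambda>\<^sup>\<mu>)\<^sup>2 = - S\<^sup>\<lambda>\<^sup>\<lambda> S\<^sup>\<mu>\<^sup>\<mu>\<close>; squaring shows \<open>(S\<^sup>\<lambda>\<^sup>\<mu>)\<^sup>4 = 0\<close>, so the invertible component is a \<open>T\<^sup>a\<^sup>b\<close>.

  When \<open>t = T\<^sup>i\<^sup>j\<close> is invertible, the third relation forces
  \<open>S\<^sup>\<lambda>\<^sup>\<mu> = - t\<^sup>-\<^sup>1 (\<theta>\<^sup>i\<^sup>\<lambda> \<theta>\<^sup>j\<^sup>\<mu> + \<theta>\<^sup>i\<^sup>\<mu> \<theta>\<^sup>j\<^sup>\<lambda>)\<close>.  Conversely this formula satisfies all the relations as
  soon as the reduced ones hold, because \<open>t \<theta>\<^sup>c\<^sup>\<mu> = T\<^sup>i\<^sup>c \<theta>\<^sup>j\<^sup>\<mu> + T\<^sup>c\<^sup>j \<theta>\<^sup>i\<^sup>\<mu>\<close> reduces every identity to one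
  between the anticommuting elements \<open>\<theta>\<^sup>i\<^sup>\<lambda>\<close> and \<open>\<theta>\<^sup>j\<^sup>\<lambda>\<close>.  Substituting the formula for the generators
  \<open>S\<^sup>\<lambda>\<^sup>\<mu>\<close> is therefore a retraction of free superalgebras that induces the isomorphism.
\<close>

section \<open>Systems of relations\<close>

lemma satisfied_Un: "satisfied (E \<union> F) \<longleftrightarrow> satisfied E \<and> satisfied F"
  unfolding satisfied_def by (rule ball_Un)

lemma satisfiedD: "\<lbrakk>satisfied E; (l, r) \<in> E\<rbrakk> \<Longrightarrow> l = r"
  unfolding satisfied_def by (drule (1) bspec) simp

lemma satisfiedI: "(\<And>l r. (l, r) \<in> E \<Longrightarrow> l = r) \<Longrightarrow> satisfied E"
  by (simp add: satisfied_def split_paired_all)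

text \<open>The left side has exactly the shape in which \<open>T_symmetry\<close> and
  \<open>S_symmetry\<close> are defined, so unfolding turns such a set of pairs into equations
  quantified over the index ranges.\<close>

lemma satisfied_two:
  "satisfied {(f a b, g a b) | a b. a \<in> A \<and> b \<in> B} \<longleftrightarrow> (\<forall>a\<in>A. \<forall>b\<in>B. f a b = g a b)" (is "?l = ?r")
proof
  assume ?l then show ?r by (intro ballI) (rule satisfiedD, assumption, blast)
next
  assume r: ?r show ?l
  proof (rule satisfiedI)
    fix l r assume "(l, r) \<in> {(f a b, g a b) | a b. a \<in> A \<and> b \<in> B}"
    then obtain a b where "l = f a b" "r = g a b" "a \<in> A" "b \<in> B" by blast
    then show "l = r" using r by blast
  qed
qed

lemma satisfied_four:
  "satisfied {(f a b c d, g a b c d) | a b c d. a \<in> A \<and> b \<in> B \<and> c \<in> C \<and> d \<in> D} \<longleftrightarrow>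
    (\<forall>a\<in>A. \<forall>b\<in>B. \<forall>c\<in>C. \<forall>d\<in>D. f a b c d = g a b c d)" (is "?l = ?r")
proof
  assume ?l then show ?r by (intro ballI) (rule satisfiedD, assumption, blast)
next
  assume r: ?r show ?l
  proof (rule satisfiedI)
    fix l r assume "(l, r) \<in> {(f a b c d, g a b c d) | a b c d. a \<in> A \<and> b \<in> B \<and> c \<in> C \<and> d \<in> D}"
    then obtain a b c d where "l = f a b c d" "r = g a b c d" "a \<in> A" "b \<in> B" "c \<in> C" "d \<in> D" by blast
    then show "l = r" using r by blast
  qed
qed

lemma satisfied_reduced_super_plucker:
  "satisfied (reduced_super_plucker R n m T \<theta>) \<longleftrightarrow>
    (\<forall>a\<in>{1..n}. \<forall>b\<in>{1..n}. \<forall>c\<in>{1..n}. \<forall>d\<in>{1..n}.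
      T a b \<otimes>\<^bsub>R\<^esub> T c d = (T a c \<otimes>\<^bsub>R\<^esub> T b d) \<oplus>\<^bsub>R\<^esub> (T a d \<otimes>\<^bsub>R\<^esub> T c b)) \<and>
    (\<forall>a\<in>{1..n}. \<forall>b\<in>{1..n}. \<forall>c\<in>{1..n}. \<forall>k\<in>{1..m}.
      T a b \<otimes>\<^bsub>R\<^esub> \<theta> c k = (T a c \<otimes>\<^bsub>R\<^esub> \<theta> b k) \<oplus>\<^bsub>R\<^esub> (T c b \<otimes>\<^bsub>R\<^esub> \<theta> a k))"
  unfolding reduced_super_plucker_def satisfied_Un satisfied_four by (rule refl)

lemma satisfied_super_plucker:
  "satisfied (super_plucker R n m T \<theta> S) \<longleftrightarrow>
    satisfied (reduced_super_plucker R n m T \<theta>) \<and>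
    (\<forall>a\<in>{1..n}. \<forall>b\<in>{1..n}. \<forall>l\<in>{1..m}. \<forall>k\<in>{1..m}.
      T a b \<otimes>\<^bsub>R\<^esub> S l k = (\<ominus>\<^bsub>R\<^esub> (\<theta> a l \<otimes>\<^bsub>R\<^esub> \<theta> b k)) \<ominus>\<^bsub>R\<^esub> (\<theta> a k \<otimes>\<^bsub>R\<^esub> \<theta> b l)) \<and>
    (\<forall>a\<in>{1..n}. \<forall>r\<in>{1..m}. \<forall>l\<in>{1..m}. \<forall>k\<in>{1..m}.
      \<theta> a r \<otimes>\<^bsub>R\<^esub> S l k = (\<ominus>\<^bsub>R\<^esub> (\<theta> a l \<otimes>\<^bsub>R\<^esub> S k r)) \<ominus>\<^bsub>R\<^esub> (\<theta> a k \<otimes>\<^bsub>R\<^esub> S l r)) \<and>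
    (\<forall>q\<in>{1..m}. \<forall>r\<in>{1..m}. \<forall>l\<in>{1..m}. \<forall>k\<in>{1..m}.
      S q r \<otimes>\<^bsub>R\<^esub> S l k = (\<ominus>\<^bsub>R\<^esub> (S q l \<otimes>\<^bsub>R\<^esub> S k r)) \<ominus>\<^bsub>R\<^esub> (S q k \<otimes>\<^bsub>R\<^esub> S l r))"
  unfolding super_plucker_def satisfied_Un satisfied_four conj_assoc by (rule refl)

text \<open>The relations evaluate the last family only at indices in range. This allows the class
  of a lifted formula to be exchanged for the formula in the quotient.\<close>

lemma satisfied_super_plucker_cong:
  assumes "\<And>l k. \<lbrakk>l \<in> {1..m}; k \<in> {1..m}\<rbrakk> \<Longrightarrow> U l k = U' l k"
  shows "satisfied (super_plucker R n m T \<theta> U) \<longleftrightarrow> satisfied (super_plucker R n m T \<theta> U')"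
  unfolding satisfied_super_plucker
  by (simp add: assms cong: ball_cong del: atLeastAtMost_iff One_nat_def)

section \<open>The chart of an invertible component\<close>

text \<open>The ordinary, ungraded center. It contains the classes of even generators and of
  products of two odd ones, and takes the place of evenness in rings that carry no grading.\<close>

definition center :: "('a, 'b) ring_scheme \<Rightarrow> 'a set" where
  "center R = {z \<in> carrier R. \<forall>y\<in>carrier R. z \<otimes>\<^bsub>R\<^esub> y = y \<otimes>\<^bsub>R\<^esub> z}"

section \<open>Arithmetic with central factors\<close>

context ring
begin

lemma center_carrier: "z \<in> center R \<Longrightarrow> z \<in> carrier R"
  by (simp add: center_def)

lemma center_commute: "\<lbrakk>z \<in> center R; y \<in> carrier R\<rbrakk> \<Longrightarrow> z \<otimes> y = y \<otimes> z"
  by (simp add: center_def)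

lemma center_left_commute:
  "\<lbrakk>z \<in> center R; y \<in> carrier R; w \<in> carrier R\<rbrakk> \<Longrightarrow> y \<otimes> (z \<otimes> w) = z \<otimes> (y \<otimes> w)"
  by (metis center_carrier center_commute m_assoc)

lemma center_mult_mult:
  "\<lbrakk>z \<in> center R; z' \<in> center R; y \<in> carrier R; y' \<in> carrier R\<rbrakk> \<Longrightarrow>
    (z \<otimes> y) \<otimes> (z' \<otimes> y') = (z \<otimes> z') \<otimes> (y \<otimes> y')"
  by (simp add: center_carrier center_left_commute m_assoc)

lemma center_add: "\<lbrakk>z \<in> center R; w \<in> center R\<rbrakk> \<Longrightarrow> z \<oplus> w \<in> center R"
  by (simp add: center_def l_distr r_distr)

lemma center_minus: "z \<in> center R \<Longrightarrow> \<ominus> z \<in> center R"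
  by (simp add: center_def l_minus r_minus)

lemma center_mult:
  assumes "z \<in> center R" "w \<in> center R" shows "z \<otimes> w \<in> center R"
proof -
  have "(z \<otimes> w) \<otimes> y = y \<otimes> (z \<otimes> w)" if "y \<in> carrier R" for y
    using assms that by (metis center_carrier center_commute m_assoc)
  moreover have "z \<otimes> w \<in> carrier R"
    using assms by (simp add: center_carrier)
  ultimately show ?thesis unfolding center_def by blast
qed

end

text \<open>Parity enters as centrality of the \<open>T a b\<close> and of \<open>u\<close>, and as
  anticommutation of the \<open>\<theta> a l\<close>. The locale can thus be instantiated in a plain
  quotient ring.\<close>

locale plucker_chart = ring R for R (structure) +
  fixes n m :: nat and T \<theta> :: "nat \<Rightarrow> nat \<Rightarrow> 'a" and i j :: nat and u :: 'a
  assumes T_center: "\<lbrakk>a \<in> {1..n}; b \<in> {1..n}\<rbrakk> \<Longrightarrow> T a b \<in> center R"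
    and theta_carrier: "\<lbrakk>a \<in> {1..n}; l \<in> {1..m}\<rbrakk> \<Longrightarrow> \<theta> a l \<in> carrier R"
    and theta_anticommute: "\<lbrakk>a \<in> {1..n}; l \<in> {1..m}; b \<in> {1..n}; k \<in> {1..m}\<rbrakk> \<Longrightarrow>
      \<theta> a l \<otimes> \<theta> b k = \<ominus> (\<theta> b k \<otimes> \<theta> a l)"
    and T_antisymmetric: "\<lbrakk>a \<in> {1..n}; b \<in> {1..n}\<rbrakk> \<Longrightarrow> T a b = \<ominus> T b a"
    and reduced: "satisfied (reduced_super_plucker R n m T \<theta>)"
    and i: "i \<in> {1..n}" and j: "j \<in> {1..n}"
    and u_center: "u \<in> center R" and T_u: "T i j \<otimes> u = \<one>"
begin

declare atLeastAtMost_iff [simp del] One_nat_def [simp del]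

text \<open>The bracket of the formula for \<open>S\<close>, kept apart from the central factor
  \<open>u\<close> so that the identities can first be checked on products of the
  \<open>\<theta> i l\<close> and \<open>\<theta> j l\<close>.\<close>

definition Z :: "nat \<Rightarrow> nat \<Rightarrow> 'a" where
  "Z l k = \<theta> i l \<otimes> \<theta> j k \<oplus> \<theta> i k \<otimes> \<theta> j l"

definition S :: "nat \<Rightarrow> nat \<Rightarrow> 'a" where
  "S l k = \<ominus> (u \<otimes> Z l k)"

lemmas closed = T_center center_carrier theta_carrier i j u_center

lemma Z_carrier: "\<lbrakk>l \<in> {1..m}; k \<in> {1..m}\<rbrakk> \<Longrightarrow> Z l k \<in> carrier R"
  by (simp add: Z_def theta_carrier i j)

lemma S_carrier: "\<lbrakk>l \<in> {1..m}; k \<in> {1..m}\<rbrakk> \<Longrightarrow> S l k \<in> carrier R"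
  by (simp add: S_def Z_carrier center_carrier u_center)

text \<open>As \<open>u\<close> is central, the one-sided equation \<open>T_u\<close> makes it a
  two-sided inverse. Identities may therefore be checked after multiplication by a power of
  \<open>T i j\<close>.\<close>

lemma T_cancel:
  assumes "T i j \<otimes> v = w" "v \<in> carrier R"
  shows "v = u \<otimes> w"
proof -
  have "u \<otimes> w = (u \<otimes> T i j) \<otimes> v"
    using assms by (auto simp: m_assoc closed)
  also have "u \<otimes> T i j = \<one>"
    using T_u center_commute[OF u_center, of "T i j"] by (simp add: closed)
  finally show ?thesis using assms by simp
qed

text \<open>The second reduced relation at the pair \<open>i\<close>, \<open>j\<close>: up to the
  unit \<open>T i j\<close>, every \<open>\<theta> c k\<close> is a combination of
  \<open>\<theta> i k\<close> and \<open>\<theta> j k\<close> with coefficients independent of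
  \<open>k\<close>.\<close>

lemma T_theta:
  "\<lbrakk>c \<in> {1..n}; k \<in> {1..m}\<rbrakk> \<Longrightarrow> T i j \<otimes> \<theta> c k = T i c \<otimes> \<theta> j k \<oplus> T c j \<otimes> \<theta> i k"
  using reduced i j unfolding satisfied_reduced_super_plucker by blast

lemma T_T:
  "\<lbrakk>c \<in> {1..n}; d \<in> {1..n}\<rbrakk> \<Longrightarrow> T i j \<otimes> T c d = T i c \<otimes> T j d \<oplus> T i d \<otimes> T c j"
  using reduced i j unfolding satisfied_reduced_super_plucker by blast

text \<open>Multiplication by the square of \<open>T i j\<close> lets both odd factors be expanded
  by \<open>T_theta\<close>. Symmetrizing in \<open>l\<close> and \<open>k\<close> leaves a multiple
  of \<open>Z l k\<close>, whose coefficient is \<open>T i j \<otimes> T c d\<close> by the first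
  Plucker relation.\<close>

lemma T_mult_S:
  assumes cd: "c \<in> {1..n}" "d \<in> {1..n}" and lk: "l \<in> {1..m}" "k \<in> {1..m}"
  shows "T c d \<otimes> S l k = (\<ominus> (\<theta> c l \<otimes> \<theta> d k)) \<ominus> (\<theta> c k \<otimes> \<theta> d l)"
proof -
  define W where "W = \<theta> c l \<otimes> \<theta> d k \<oplus> \<theta> c k \<otimes> \<theta> d l"
  have W: "W \<in> carrier R" by (simp add: W_def theta_carrier cd lk)
  define p q r s where pqrs: "p = T i c" "q = T c j" "r = T i d" "s = T d j"
  have C: "p \<in> center R" "q \<in> center R" "r \<in> center R" "s \<in> center R"
    by (simp_all add: pqrs closed cd)
  note C' = C[THEN center_carrier]
  \<comment> \<open>One factor \<open>T i j\<close> goes to each odd factor, and the coefficients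
    are collected in front. Stated for arbitrary \<open>l\<close> and \<open>k\<close>, because it
    is needed again with the two exchanged.\<close>
  have expand: "T i j \<otimes> (T i j \<otimes> (\<theta> c l \<otimes> \<theta> d k)) =
      (p \<otimes> r) \<otimes> (\<theta> j l \<otimes> \<theta> j k) \<oplus> (p \<otimes> s) \<otimes> (\<theta> j l \<otimes> \<theta> i k) \<oplus>
      ((q \<otimes> r) \<otimes> (\<theta> i l \<otimes> \<theta> j k) \<oplus> (q \<otimes> s) \<otimes> (\<theta> i l \<otimes> \<theta> i k))"
    if lk: "l \<in> {1..m}" "k \<in> {1..m}" for l k
  proof -
    have "T i j \<otimes> (T i j \<otimes> (\<theta> c l \<otimes> \<theta> d k)) = (T i j \<otimes> \<theta> c l) \<otimes> (T i j \<otimes> \<theta> d k)"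
      using cd lk center_left_commute[of "T i j" "\<theta> c l" "\<theta> d k"] by (simp add: m_assoc closed)
    also have "\<dots> = (p \<otimes> \<theta> j l \<oplus> q \<otimes> \<theta> i l) \<otimes> (r \<otimes> \<theta> j k \<oplus> s \<otimes> \<theta> i k)"
      using cd lk by (simp add: T_theta pqrs)
    finally show ?thesis
      using lk by (simp add: l_distr r_distr center_mult_mult a_ac C C' closed)
  qed
  \<comment> \<open>Exchanging \<open>l\<close> and \<open>k\<close> changes the sign of the
    \<open>j\<close>-\<open>j\<close> and \<open>i\<close>-\<open>i\<close> products, so these
    cancel in \<open>W\<close>. The mixed products are brought to the order in which they occur in
    \<open>Z l k\<close>.\<close>
  have jj: "\<theta> j k \<otimes> \<theta> j l = \<ominus> (\<theta> j l \<otimes> \<theta> j k)" and ii: "\<theta> i k \<otimes> \<theta> i l = \<ominus> (\<theta> i l \<otimes> \<theta> i k)"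
    and ji: "\<theta> j l \<otimes> \<theta> i k = \<ominus> (\<theta> i k \<otimes> \<theta> j l)" and ji': "\<theta> j k \<otimes> \<theta> i l = \<ominus> (\<theta> i l \<otimes> \<theta> j k)"
    by (rule theta_anticommute; fact i j lk)+
  have "T i j \<otimes> (T i j \<otimes> W) = (q \<otimes> r \<ominus> p \<otimes> s) \<otimes> Z l k"
  proof -
    define X Y A B where XY: "X = \<theta> i l \<otimes> \<theta> j k" "Y = \<theta> i k \<otimes> \<theta> j l"
      "A = \<theta> j l \<otimes> \<theta> j k" "B = \<theta> i l \<otimes> \<theta> i k"
    have XYc: "X \<in> carrier R" "Y \<in> carrier R" "A \<in> carrier R" "B \<in> carrier R"
      by (simp_all add: XY theta_carrier i j lk)
    have "T i j \<otimes> (T i j \<otimes> W) = T i j \<otimes> (T i j \<otimes> (\<theta> c l \<otimes> \<theta> d k)) \<oplus> T i j \<otimes> (T i j \<otimes> (\<theta> c k \<otimes> \<theta> d l))"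
      using cd lk by (simp add: W_def r_distr closed)
    also have "\<dots> = (p \<otimes> r) \<otimes> A \<oplus> (p \<otimes> s) \<otimes> (\<ominus> Y) \<oplus> ((q \<otimes> r) \<otimes> X \<oplus> (q \<otimes> s) \<otimes> B) \<oplus>
       ((p \<otimes> r) \<otimes> (\<ominus> A) \<oplus> (p \<otimes> s) \<otimes> (\<ominus> X) \<oplus> ((q \<otimes> r) \<otimes> Y \<oplus> (q \<otimes> s) \<otimes> (\<ominus> B)))"
      using lk by (simp add: expand ji ji' ii jj XY)
    also have "\<dots> = (q \<otimes> r \<ominus> p \<otimes> s) \<otimes> (X \<oplus> Y)"
      using XYc C' by algebra
    finally show ?thesis by (simp add: Z_def XY)
  qed
  also have "q \<otimes> r \<ominus> p \<otimes> s = T i j \<otimes> T c d"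
  proof -
    \<comment> \<open>\<open>T_T\<close> yields \<open>T j d\<close>, whereas the expansion produced
      \<open>s = T d j\<close>; antisymmetry supplies the minus sign of the determinant.\<close>
    have "T j d = \<ominus> s" using T_antisymmetric[OF j cd(2)] by (simp add: pqrs)
    then have "T i j \<otimes> T c d = p \<otimes> (\<ominus> s) \<oplus> r \<otimes> q"
      using T_T[OF cd] by (simp add: pqrs)
    also have "r \<otimes> q = q \<otimes> r" by (rule center_commute[OF C(3) C'(2)])
    finally show ?thesis using C' by algebra
  qed
  finally have "T i j \<otimes> (T i j \<otimes> W) = T i j \<otimes> (T c d \<otimes> Z l k)"
    using cd lk by (simp add: m_assoc closed Z_carrier)
  \<comment> \<open>Both sides are recovered from the same element by multiplication with
    \<open>u\<close>, which removes the first of the two factors \<open>T i j\<close>.\<close>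
  then have "T i j \<otimes> W = T c d \<otimes> Z l k"
    using T_cancel[of "T i j \<otimes> W"] T_cancel[OF refl, of "T c d \<otimes> Z l k"] W cd lk
    by (simp add: closed Z_carrier)
  then have "W = u \<otimes> (T c d \<otimes> Z l k)"
    by (rule T_cancel) (fact W)
  also have "\<dots> = T c d \<otimes> (u \<otimes> Z l k)"
    using cd lk by (intro center_left_commute) (simp_all add: closed Z_carrier)
  finally have "T c d \<otimes> S l k = \<ominus> W"
    using cd lk by (simp add: S_def r_minus closed Z_carrier)
  then show ?thesis
    unfolding W_def using cd lk by (simp add: minus_add minus_eq closed)
qed

text \<open>Reversing three anticommuting factors takes three transpositions, hence the sign is
  negative.\<close>

lemma theta_reverse:
  assumes "a \<in> {1..n}" "b \<in> {1..n}" "c \<in> {1..n}" "l \<in> {1..m}" "k \<in> {1..m}" "r \<in> {1..m}"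
  shows "\<theta> a l \<otimes> (\<theta> b k \<otimes> \<theta> c r) = \<ominus> (\<theta> c r \<otimes> (\<theta> b k \<otimes> \<theta> a l))"
proof -
  have "\<theta> a l \<otimes> (\<theta> b k \<otimes> \<theta> c r) = (\<ominus> (\<theta> b k \<otimes> \<theta> a l)) \<otimes> \<theta> c r"
    using assms by (subst theta_anticommute[symmetric]) (auto simp: m_assoc theta_carrier)
  also have "\<dots> = \<ominus> (\<theta> b k \<otimes> (\<theta> a l \<otimes> \<theta> c r))"
    using assms by (simp add: m_assoc l_minus theta_carrier)
  also have "\<theta> a l \<otimes> \<theta> c r = \<ominus> (\<theta> c r \<otimes> \<theta> a l)"
    using assms by (intro theta_anticommute) auto
  also have "\<theta> b k \<otimes> (\<ominus> (\<theta> c r \<otimes> \<theta> a l)) = (\<ominus> (\<theta> b k \<otimes> \<theta> c r)) \<otimes> \<theta> a l"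
    using assms by (simp add: m_assoc l_minus r_minus theta_carrier)
  also have "\<ominus> (\<theta> b k \<otimes> \<theta> c r) = \<theta> c r \<otimes> \<theta> b k"
    using assms by (intro theta_anticommute[symmetric]) auto
  finally show ?thesis using assms by (simp add: m_assoc theta_carrier)
qed

text \<open>The sum consists of six triple products that cancel in pairs. For \<open>a = i\<close>
  the partners differ by a swap of the first two factors, for \<open>a = j\<close> by a reversal of
  all three.\<close>

lemma theta_Z_cyclic:
  assumes a: "a = i \<or> a = j" and m: "r \<in> {1..m}" "l \<in> {1..m}" "k \<in> {1..m}"
  shows "\<theta> a r \<otimes> Z l k \<oplus> \<theta> a l \<otimes> Z k r \<oplus> \<theta> a k \<otimes> Z l r = \<zero>"
proof -
  have cancel: "(X \<oplus> Y) \<oplus> (\<ominus> X \<oplus> W) \<oplus> (\<ominus> Y \<oplus> \<ominus> W) = \<zero>"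
    if "X \<in> carrier R" "Y \<in> carrier R" "W \<in> carrier R" for X Y W
    using that by algebra
  have cancel': "(X \<oplus> Y) \<oplus> (W \<oplus> \<ominus> Y) \<oplus> (\<ominus> X \<oplus> \<ominus> W) = \<zero>"
    "(X \<oplus> Y) \<oplus> (W \<oplus> \<ominus> X) \<oplus> (\<ominus> W \<oplus> \<ominus> Y) = \<zero>"
    "(X \<oplus> Y) \<oplus> (\<ominus> Y \<oplus> W) \<oplus> (\<ominus> X \<oplus> \<ominus> W) = \<zero>"
    if "X \<in> carrier R" "Y \<in> carrier R" "W \<in> carrier R" for X Y W
    using that by algebra+
  show ?thesis
  using a
  proof
    assume [simp]: "a = i"
    have swap: "\<theta> i r \<otimes> (\<theta> i l \<otimes> \<theta> j k) = \<ominus> (\<theta> i l \<otimes> (\<theta> i r \<otimes> \<theta> j k))"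
      if "r \<in> {1..m}" "l \<in> {1..m}" "k \<in> {1..m}" for r l k
    proof -
      have "\<theta> i r \<otimes> (\<theta> i l \<otimes> \<theta> j k) = (\<theta> i r \<otimes> \<theta> i l) \<otimes> \<theta> j k"
        using that by (simp add: m_assoc closed)
      also have "\<dots> = \<ominus> (\<theta> i l \<otimes> \<theta> i r) \<otimes> \<theta> j k"
        using that i by (subst theta_anticommute) auto
      finally show ?thesis
        using that by (simp add: m_assoc l_minus closed)
    qed
    show ?thesis
      using m i j swap[of l r k] swap[of k r l] swap[of k l r]
      by (simp add: Z_def r_distr theta_carrier cancel cancel')
  next
    assume [simp]: "a = j"
    show ?thesis
      using m i j theta_reverse[of j i j k l r] theta_reverse[of j i j l k r] theta_reverse[of j i j k r l]
      by (simp add: Z_def r_distr theta_carrier cancel cancel')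
  qed
qed

text \<open>The cyclic sum is linear in the odd elements with first index \<open>a\<close>, so
  \<open>T_theta\<close> reduces it to the cases \<open>a = i\<close> and \<open>a = j\<close>
  settled for \<open>Z\<close>. The fourth relation is written as a vanishing sum to make this
  linearity usable.\<close>

lemma theta_S_cyclic:
  assumes a: "a \<in> {1..n}" and m: "r \<in> {1..m}" "l \<in> {1..m}" "k \<in> {1..m}"
  shows "\<theta> a r \<otimes> S l k \<oplus> \<theta> a l \<otimes> S k r \<oplus> \<theta> a k \<otimes> S l r = \<zero>"
proof -
  define V where "V b = \<theta> b r \<otimes> Z l k \<oplus> \<theta> b l \<otimes> Z k r \<oplus> \<theta> b k \<otimes> Z l r" for b
  have V: "V b \<in> carrier R" if "b \<in> {1..n}" for b
    using that m by (simp add: V_def theta_carrier Z_carrier)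
  have V0: "V i = \<zero>" "V j = \<zero>"
    using theta_Z_cyclic m by (simp_all add: V_def)
  have "T i j \<otimes> V a = (T i j \<otimes> \<theta> a r) \<otimes> Z l k \<oplus> (T i j \<otimes> \<theta> a l) \<otimes> Z k r \<oplus> (T i j \<otimes> \<theta> a k) \<otimes> Z l r"
    using a m by (simp add: V_def r_distr m_assoc closed Z_carrier)
  also have "\<dots> = T i a \<otimes> V j \<oplus> T a j \<otimes> V i"
  proof -
    have "(p \<otimes> y \<oplus> q \<otimes> x) \<otimes> z \<oplus> (p \<otimes> y' \<oplus> q \<otimes> x') \<otimes> z' \<oplus> (p \<otimes> y'' \<oplus> q \<otimes> x'') \<otimes> z'' =
      p \<otimes> (y \<otimes> z \<oplus> y' \<otimes> z' \<oplus> y'' \<otimes> z'') \<oplus> q \<otimes> (x \<otimes> z \<oplus> x' \<otimes> z' \<oplus> x'' \<otimes> z'')"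
      if "p \<in> carrier R" "q \<in> carrier R" "x \<in> carrier R" "x' \<in> carrier R" "x'' \<in> carrier R"
        "y \<in> carrier R" "y' \<in> carrier R" "y'' \<in> carrier R" "z \<in> carrier R" "z' \<in> carrier R" "z'' \<in> carrier R"
      for p q x x' x'' y y' y'' z z' z''
      using that by (simp add: m_assoc l_distr r_distr a_ac)
    then show ?thesis
      using a m by (simp add: V_def T_theta closed Z_carrier)
  qed
  finally have "T i j \<otimes> V a = \<zero>"
    using a by (simp add: V0 closed)
  then have "V a = u \<otimes> \<zero>"
    by (rule T_cancel) (use V a in auto)
  then have "V a = \<zero>" by (simp add: closed)
  \<comment> \<open>The factor \<open>\<ominus> u\<close> in \<open>S\<close> is central and common
    to all three terms.\<close>
  moreover have "\<theta> a r \<otimes> S l k \<oplus> \<theta> a l \<otimes> S k r \<oplus> \<theta> a k \<otimes> S l r = \<ominus> (u \<otimes> V a)"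
    using a m by (simp add: V_def S_def r_minus r_distr minus_add center_left_commute closed Z_carrier)
  ultimately show ?thesis by (simp add: closed)
qed

lemma S_sym: "\<lbrakk>l \<in> {1..m}; k \<in> {1..m}\<rbrakk> \<Longrightarrow> S l k = S k l"
  by (simp add: S_def Z_def a_comm theta_carrier i j)

text \<open>Expanding the first factor of each product exhibits the sum as a combination of the
  cyclic sums of \<open>theta_S_cyclic\<close> for \<open>i\<close> and \<open>j\<close>.\<close>

lemma S_S_cyclic:
  assumes m: "q \<in> {1..m}" "r \<in> {1..m}" "l \<in> {1..m}" "k \<in> {1..m}"
  shows "S q r \<otimes> S l k \<oplus> S q l \<otimes> S k r \<oplus> S q k \<otimes> S l r = \<zero>"
proof -
  define V where "V b = \<theta> b r \<otimes> S l k \<oplus> \<theta> b l \<otimes> S k r \<oplus> \<theta> b k \<otimes> S l r" for b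
  have V0: "V i = \<zero>" "V j = \<zero>"
    using theta_S_cyclic m i j by (simp_all add: V_def)
  \<comment> \<open>One product in \<open>Z q e\<close> is turned round, at the cost of a sign, so
    that in both terms the odd element with the varying index \<open>e\<close> stands next to
    \<open>w\<close>, as in \<open>V\<close>.\<close>
  have S: "S q e \<otimes> w = (\<ominus> u) \<otimes> (\<theta> i q \<otimes> (\<theta> j e \<otimes> w) \<ominus> \<theta> j q \<otimes> (\<theta> i e \<otimes> w))"
    if "e \<in> {1..m}" "w \<in> carrier R" for e w
  proof -
    have "\<theta> i e \<otimes> \<theta> j q = \<ominus> (\<theta> j q \<otimes> \<theta> i e)"
      using that m i j by (intro theta_anticommute)
    then show ?thesis
      using that m by (simp add: S_def Z_def l_distr minus_eq l_minus r_minus r_distr minus_add m_assoc closed)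
  qed
  have alg: "v \<otimes> (x \<otimes> y1 \<ominus> z \<otimes> w1) \<oplus> v \<otimes> (x \<otimes> y2 \<ominus> z \<otimes> w2) \<oplus> v \<otimes> (x \<otimes> y3 \<ominus> z \<otimes> w3)
    = v \<otimes> (x \<otimes> (y1 \<oplus> y2 \<oplus> y3) \<ominus> z \<otimes> (w1 \<oplus> w2 \<oplus> w3))"
    if "v \<in> carrier R" "x \<in> carrier R" "z \<in> carrier R" "y1 \<in> carrier R" "y2 \<in> carrier R" "y3 \<in> carrier R"
      "w1 \<in> carrier R" "w2 \<in> carrier R" "w3 \<in> carrier R" for v x z y1 y2 y3 w1 w2 w3
    using that by (simp add: minus_eq r_distr r_minus minus_add a_ac)
  have "S q r \<otimes> S l k \<oplus> S q l \<otimes> S k r \<oplus> S q k \<otimes> S l r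
     = (\<ominus> u) \<otimes> (\<theta> i q \<otimes> V j \<ominus> \<theta> j q \<otimes> V i)"
    using m by (simp add: S S_carrier alg V_def closed)
  then show ?thesis
    using m by (simp add: V0 closed minus_eq)
qed

lemma satisfied_super_plucker_S: "satisfied (super_plucker R n m T \<theta> S)"
proof -
  have solve: "x = \<ominus> y \<ominus> z" if "x \<oplus> y \<oplus> z = \<zero>" "x \<in> carrier R" "y \<in> carrier R" "z \<in> carrier R" for x y z
  proof -
    have "x = \<ominus> (y \<oplus> z)"
      using that by (intro minus_equality[symmetric]) (simp_all add: a_ac)
    then show ?thesis using that by (simp add: minus_add minus_eq)
  qed
  have "\<theta> a r \<otimes> S l k = \<ominus> (\<theta> a l \<otimes> S k r) \<ominus> \<theta> a k \<otimes> S l r"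
    if "a \<in> {1..n}" "r \<in> {1..m}" "l \<in> {1..m}" "k \<in> {1..m}" for a r l k
    using that theta_S_cyclic by (intro solve) (auto simp: theta_carrier S_carrier)
  moreover have "S q r \<otimes> S l k = \<ominus> (S q l \<otimes> S k r) \<ominus> S q k \<otimes> S l r"
    if "q \<in> {1..m}" "r \<in> {1..m}" "l \<in> {1..m}" "k \<in> {1..m}" for q r l k
    using that S_S_cyclic by (intro solve) (auto simp: S_carrier)
  ultimately show ?thesis
    using reduced T_mult_S unfolding satisfied_super_plucker by blast
qed

end

section \<open>Nilpotence of the odd-odd components\<close>

context comm_superalgebra
begin

lemma even_carrier: "x \<in> even_part A \<Longrightarrow> x \<in> carrier A"
  using module.submoduleE(1)[OF module even_submodule] by blast

section \<open>Absence of torsion in characteristic zero\<close>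

lemma smult_eq_zero:
  assumes x: "x \<in> carrier A" and "c \<odot> x = \<zero>" and "c \<noteq> 0"
  shows "x = \<zero>"
proof -
  interpret M: module scalars A by (rule module)
  have "x = (inverse c * c) \<odot> x"
    using x M.smult_one assms(3) by (simp add: scalars_def)
  also have "\<dots> = inverse c \<odot> (c \<odot> x)"
    using x M.smult_assoc1 by (simp add: scalars_def)
  finally show ?thesis
    using assms(2) M.smult_r_null by (simp add: scalars_def)
qed

lemma double_smult:
  assumes "x \<in> carrier A" shows "2 \<odot> x = x \<oplus> x"
proof -
  interpret M: module scalars A by (rule module)
  show ?thesis
    using M.smult_l_distr[of 1 1 x] M.smult_one[of x] assms by (simp add: scalars_def)
qed

lemma double_eq_zero:
  assumes "x \<in> carrier A" "x \<oplus> x = \<zero>" shows "x = \<zero>"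
  using smult_eq_zero[of x 2] double_smult[of x] assms by simp

lemma triple_eq_zero:
  assumes "x \<in> carrier A" "x \<oplus> x \<oplus> x = \<zero>" shows "x = \<zero>"
proof -
  interpret M: module scalars A by (rule module)
  have "3 \<odot> x = x \<oplus> x \<oplus> x"
    using M.smult_l_distr[of 2 1 x] M.smult_one[of x] double_smult[of x] assms(1) by (simp add: scalars_def)
  then show ?thesis using smult_eq_zero[of x 3] assms by simp
qed

text \<open>The exponent 4 comes from \<open>x \<otimes> x = \<zero>\<close> for the square
  \<open>x\<close> of \<open>S l k\<close>.\<close>

lemma S_nilpotent:
  assumes S: "\<And>l k. \<lbrakk>l \<in> {1..m}; k \<in> {1..m}\<rbrakk> \<Longrightarrow> S l k \<in> even_part A"
    and sym: "\<And>l k. \<lbrakk>l \<in> {1..m}; k \<in> {1..m}\<rbrakk> \<Longrightarrow> S l k = S k l"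
    and rel: "satisfied (super_plucker A n m T \<theta> S)"
    and l: "l \<in> {1..m}" and k: "k \<in> {1..m}"
  shows "S l k [^] (4::nat) = \<zero>"
proof -
  have eq: "S q r \<otimes> S l k = \<ominus> (S q l \<otimes> S k r) \<ominus> (S q k \<otimes> S l r)"
    if "q \<in> {1..m}" "r \<in> {1..m}" "l \<in> {1..m}" "k \<in> {1..m}" for q r l k
    using rel that unfolding satisfied_super_plucker by blast
  have carr: "S l k \<in> carrier A" if "l \<in> {1..m}" "k \<in> {1..m}" for l k
    using S that even_carrier by blast
  have move: "x \<oplus> y \<oplus> z = \<zero>" if "x = \<ominus> y \<ominus> z" "x \<in> carrier A" "y \<in> carrier A" "z \<in> carrier A" for x y z
    unfolding that(1) using that(2-) by algebra
  have square: "S q q \<otimes> S q q = \<zero>" if q: "q \<in> {1..m}" for q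
    using move[OF eq[OF q q q q]] carr[OF q q] triple_eq_zero[of "S q q \<otimes> S q q"] by simp
  define x y where "x = S l k \<otimes> S l k" and "y = S l l \<otimes> S k k"
  have xy: "x \<in> carrier A" "y \<in> carrier A"
    using carr l k by (simp_all add: x_def y_def)
  \<comment> \<open>The last relation with the pair \<open>l\<close>, \<open>k\<close> taken twice.
    Its right side contains \<open>x\<close> again, and this produces the factor 2.\<close>
  have "x = \<ominus> y \<ominus> x"
    using eq[OF l k l k] sym[OF k l] by (simp add: x_def y_def)
  then have "x \<oplus> y \<oplus> x = \<zero>"
    using xy by (intro move)
  then have "x \<oplus> x = \<ominus> y"
    using xy by (intro minus_equality[symmetric]) (simp_all add: a_ac)
  moreover have "y \<otimes> y = \<zero>"
  proof -
    have "y \<otimes> y = (S l l \<otimes> S l l) \<otimes> (S k k \<otimes> S k k)"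
      \<comment> \<open>Even elements commute, so \<open>y \<otimes> y\<close> regroups into a
        product of two vanishing squares.\<close>
      unfolding y_def using carr l k even_commute[OF S[OF l l], of "S k k"]
      by (smt (verit) m_assoc m_closed)
    then show ?thesis using square l carr k by simp
  qed
  ultimately have "(x \<oplus> x) \<otimes> (x \<oplus> x) = \<zero>"
    using xy by (simp add: l_minus r_minus)
  \<comment> \<open>Four times \<open>x \<otimes> x\<close> vanishes; the factor 2 is divided out
    twice.\<close>
  then have "(x \<otimes> x \<oplus> x \<otimes> x) \<oplus> (x \<otimes> x \<oplus> x \<otimes> x) = \<zero>"
    using xy by (simp add: l_distr r_distr)
  then have "x \<otimes> x \<oplus> x \<otimes> x = \<zero>"
    using xy double_eq_zero[of "x \<otimes> x \<oplus> x \<otimes> x"] by simp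
  then have "x \<otimes> x = \<zero>"
    using xy double_eq_zero[of "x \<otimes> x"] by simp
  then show ?thesis
    using carr[OF l k] by (simp add: x_def numeral_eq_Suc m_assoc)
qed

text \<open>Powers of a unit are units, and zero is a unit only in the zero ring; here the condition
  \<open>\<one> \<noteq> \<zero>\<close> enters.\<close>

lemma unit_not_nilpotent:
  assumes "\<one> \<noteq> \<zero>" "x \<in> Units A"
  shows "\<not> nilpotent A x"
proof
  assume "nilpotent A x"
  then obtain k :: nat where "x [^] k = \<zero>" unfolding nilpotent_def by blast
  moreover have "x [^] k \<in> Units A"
    using assms(2) by (induction k) auto
  ultimately have "\<zero> \<in> Units A" by simp
  then have "\<one> = inv \<zero> \<otimes> \<zero>" and "inv \<zero> \<in> carrier A"
    using Units_l_inv[of \<zero>] Units_inv_closed[of \<zero>] by metis+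
  then show False using assms(1) r_null[of "inv \<zero>"] by metis
qed

lemma nilpotent_and_nondegenerate:
  assumes "\<one> \<noteq> \<zero>" "even_bivector_components A n m T \<theta> S"
    "some_even_component_invertible A n m T S" "satisfied (super_plucker A n m T \<theta> S)"
  shows "(\<forall>l\<in>{1..m}. \<forall>k\<in>{1..m}. nilpotent A (S l k)) \<and> nondegenerate A n T"
proof -
  have "satisfied (S_symmetry m S)"
    using assms(2) unfolding even_bivector_components_def by blast
  then have sym: "\<forall>k\<in>{1..m}. \<forall>l\<in>{1..m}. S l k = S k l"
    unfolding S_symmetry_def satisfied_two .
  have nil: "nilpotent A (S l k)" if "l \<in> {1..m}" "k \<in> {1..m}" for l k
    unfolding nilpotent_def
  proof
    show "S l k [^] (4::nat) = \<zero>"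
      using assms(2) sym that unfolding even_bivector_components_def
      by (intro S_nilpotent[OF _ _ assms(4)]) blast+
  qed
  then show ?thesis
    using assms(3) unit_not_nilpotent[OF assms(1)]
    unfolding some_even_component_invertible_def nondegenerate_def by blast
qed

end

section \<open>Ideals of relations and quotients\<close>

text \<open>For a ring homomorphism \<open>h\<close> and relations in its domain this is the
  condition for \<open>h\<close> to factor through the quotient by the ideal of the
  relations.\<close>

definition identifies :: "('a \<Rightarrow> 'b) \<Rightarrow> ('a \<times> 'a) set \<Rightarrow> bool" where
  "identifies h E \<longleftrightarrow> (\<forall>(l, r)\<in>E. h l = h r)"

lemma identifiesD: "\<lbrakk>identifies h E; (l, r) \<in> E\<rbrakk> \<Longrightarrow> h l = h r"
  unfolding identifies_def by (drule (1) bspec) simp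

lemma identifies_iff_satisfied: "identifies h E \<longleftrightarrow> satisfied (map_prod h h ` E)"
  unfolding identifies_def satisfied_def by (simp add: case_prod_beta)

lemma identifies_Un: "identifies h (E \<union> F) \<longleftrightarrow> identifies h E \<and> identifies h F"
  unfolding identifies_def by (rule ball_Un)

lemma identifies_mono: "\<lbrakk>identifies h E; F \<subseteq> E\<rbrakk> \<Longrightarrow> identifies h F"
  unfolding identifies_def by blast

lemma identifies_two:
  "identifies h {(f a b, g a b) | a b. a \<in> A \<and> b \<in> B} \<longleftrightarrow>
    (\<forall>a\<in>A. \<forall>b\<in>B. h (f a b) = h (g a b))"
proof -
  have "map_prod h h ` {(f a b, g a b) | a b. a \<in> A \<and> b \<in> B} =
      {(h (f a b), h (g a b)) | a b. a \<in> A \<and> b \<in> B}"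
    by force
  then show ?thesis
    unfolding identifies_iff_satisfied by (simp only: satisfied_two)
qed

lemma identifies_four:
  "identifies h {(f a b c d, g a b c d) | a b c d. a \<in> A \<and> b \<in> B \<and> c \<in> C \<and> d \<in> D} \<longleftrightarrow>
    (\<forall>a\<in>A. \<forall>b\<in>B. \<forall>c\<in>C. \<forall>d\<in>D. h (f a b c d) = h (g a b c d))"
proof -
  have "map_prod h h ` {(f a b c d, g a b c d) | a b c d. a \<in> A \<and> b \<in> B \<and> c \<in> C \<and> d \<in> D} =
      {(h (f a b c d), h (g a b c d)) | a b c d. a \<in> A \<and> b \<in> B \<and> c \<in> C \<and> d \<in> D}"
    by force
  then show ?thesis
    unfolding identifies_iff_satisfied by (simp only: satisfied_four)
qed

section \<open>Transport of the relations along a ring homomorphism\<close>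

lemma (in ring_hom_ring) hom_minus:
  "\<lbrakk>x \<in> carrier R; y \<in> carrier R\<rbrakk> \<Longrightarrow> h (x \<ominus> y) = h x \<ominus>\<^bsub>S\<^esub> h y"
  by (simp add: a_minus_def)

lemma (in ring_hom_ring) identifies_T_symmetry:
  assumes "\<And>a b. \<lbrakk>a \<in> {1..n}; b \<in> {1..n}\<rbrakk> \<Longrightarrow> T a b \<in> carrier R"
  shows "identifies h (T_symmetry R n T) \<longleftrightarrow> satisfied (T_symmetry S n (\<lambda>a b. h (T a b)))"
  unfolding T_symmetry_def identifies_two satisfied_two using assms
  by (simp cong: ball_cong del: atLeastAtMost_iff)

lemma (in ring_hom_ring) identifies_reduced_super_plucker:
  assumes "\<And>a b. \<lbrakk>a \<in> {1..n}; b \<in> {1..n}\<rbrakk> \<Longrightarrow> T a b \<in> carrier R"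
    and "\<And>a l. \<lbrakk>a \<in> {1..n}; l \<in> {1..m}\<rbrakk> \<Longrightarrow> \<theta> a l \<in> carrier R"
  shows "identifies h (reduced_super_plucker R n m T \<theta>) \<longleftrightarrow>
    satisfied (reduced_super_plucker S n m (\<lambda>a b. h (T a b)) (\<lambda>a l. h (\<theta> a l)))"
  unfolding reduced_super_plucker_def identifies_Un identifies_four satisfied_Un satisfied_four
  using assms by (simp cong: ball_cong del: atLeastAtMost_iff)

lemma (in ring_hom_ring) identifies_super_plucker:
  assumes "\<And>a b. \<lbrakk>a \<in> {1..n}; b \<in> {1..n}\<rbrakk> \<Longrightarrow> T a b \<in> carrier R"
    and "\<And>a l. \<lbrakk>a \<in> {1..n}; l \<in> {1..m}\<rbrakk> \<Longrightarrow> \<theta> a l \<in> carrier R"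
    and "\<And>l k. \<lbrakk>l \<in> {1..m}; k \<in> {1..m}\<rbrakk> \<Longrightarrow> U l k \<in> carrier R"
  shows "identifies h (super_plucker R n m T \<theta> U) \<longleftrightarrow>
    satisfied (super_plucker S n m (\<lambda>a b. h (T a b)) (\<lambda>a l. h (\<theta> a l)) (\<lambda>l k. h (U l k)))"
  unfolding super_plucker_def identifies_Un identifies_four satisfied_Un satisfied_four
    identifies_reduced_super_plucker[of n T m \<theta>, OF assms(1,2), simplified]
  using assms by (simp add: hom_minus cong: ball_cong del: atLeastAtMost_iff)

section \<open>The ideal generated by a system of relations\<close>

context ring
begin

lemma T_symmetry_carrier:
  assumes "\<And>a b. \<lbrakk>a \<in> {1..n}; b \<in> {1..n}\<rbrakk> \<Longrightarrow> T a b \<in> carrier R"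
  shows "T_symmetry R n T \<subseteq> carrier R \<times> carrier R"
  unfolding T_symmetry_def using assms by blast

lemma reduced_super_plucker_carrier:
  assumes "\<And>a b. \<lbrakk>a \<in> {1..n}; b \<in> {1..n}\<rbrakk> \<Longrightarrow> T a b \<in> carrier R"
    and "\<And>a l. \<lbrakk>a \<in> {1..n}; l \<in> {1..m}\<rbrakk> \<Longrightarrow> \<theta> a l \<in> carrier R"
  shows "reduced_super_plucker R n m T \<theta> \<subseteq> carrier R \<times> carrier R"
  unfolding reduced_super_plucker_def using assms by blast

lemma super_plucker_carrier:
  assumes "\<And>a b. \<lbrakk>a \<in> {1..n}; b \<in> {1..n}\<rbrakk> \<Longrightarrow> T a b \<in> carrier R"
    and "\<And>a l. \<lbrakk>a \<in> {1..n}; l \<in> {1..m}\<rbrakk> \<Longrightarrow> \<theta> a l \<in> carrier R"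
    and "\<And>l k. \<lbrakk>l \<in> {1..m}; k \<in> {1..m}\<rbrakk> \<Longrightarrow> U l k \<in> carrier R"
  shows "super_plucker R n m T \<theta> U \<subseteq> carrier R \<times> carrier R"
  unfolding super_plucker_def
  using reduced_super_plucker_carrier[of n T m \<theta>] assms by blast

lemma relation_ideal_ideal:
  assumes "E \<subseteq> carrier R \<times> carrier R" shows "ideal (relation_ideal R E) R"
  unfolding relation_ideal_def using assms by (intro genideal_ideal) blast

lemma relation_ideal_identifies:
  assumes E: "E \<subseteq> carrier R \<times> carrier R"
  shows "identifies ((+>) (relation_ideal R E)) E"
  unfolding identifies_def
proof (clarify)
  fix l r assume lr: "(l, r) \<in> E"
  interpret ideal "relation_ideal R E" R by (rule relation_ideal_ideal[OF E])
  have "l \<ominus> r \<in> relation_ideal R E"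
    unfolding relation_ideal_def using E lr by (intro subsetD[OF genideal_self]) blast+
  then show "relation_ideal R E +> l = relation_ideal R E +> r"
    using E lr by (subst quotient_eq_iff_same_a_r_cos[symmetric, OF ideal_axioms]) auto
qed

end

text \<open>The kernel of \<open>h\<close> is an ideal that contains every generator
  \<open>l \<ominus> r\<close>, hence the whole generated ideal.\<close>

lemma (in ring_hom_ring) relation_ideal_kernel:
  assumes E: "E \<subseteq> carrier R \<times> carrier R" and h: "identifies h E" and x: "x \<in> relation_ideal R E"
  shows "h x = \<zero>\<^bsub>S\<^esub>"
proof -
  have "{l \<ominus> r | l r. (l, r) \<in> E} \<subseteq> a_kernel R S h"
  proof clarify
    fix l r assume lr: "(l, r) \<in> E"
    then have "l \<in> carrier R" "r \<in> carrier R" using E by auto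
    moreover from this have "h (l \<ominus> r) = h l \<ominus>\<^bsub>S\<^esub> h r" by (rule hom_minus)
    moreover have "h l = h r" using h lr by (rule identifiesD)
    ultimately show "l \<ominus> r \<in> a_kernel R S h"
      unfolding a_kernel_def'
      by (simp only: mem_Collect_eq R.minus_closed S.minus_eq S.r_neg hom_closed simp_thms)
  qed
  then have "relation_ideal R E \<subseteq> a_kernel R S h"
    unfolding relation_ideal_def by (rule R.genideal_minimal[OF kernel_is_ideal])
  then show ?thesis using x by (blast intro: kernel_zero)
qed

text \<open>The first isomorphism theorem for \<open>\<phi>\<close> followed by the quotient map of
  \<open>B\<close>. This composite is onto because \<open>\<phi>\<close> fixes \<open>B\<close>. Its
  kernel contains the ideal of \<open>E\<close> by \<open>E_id\<close>; conversely, if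
  \<open>\<phi> x\<close> lies in the ideal of \<open>E'\<close>, then it vanishes modulo
  \<open>E\<close> by \<open>E_sub\<close>, and so does \<open>x\<close> by
  \<open>phi_cong\<close>.\<close>

lemma superalgebra_iso_of_retraction:
  fixes A :: "('k, 'a) superalgebra" and B :: "('k, 'a) superalgebra"
  assumes A: "ring A" and B: "ring B"
    and E: "E \<subseteq> carrier A \<times> carrier A" and E': "E' \<subseteq> carrier B \<times> carrier B"
    and incl: "(\<lambda>x. x) \<in> ring_hom B A" and hom: "\<phi> \<in> ring_hom A B"
    and retract: "\<And>y. y \<in> carrier B \<Longrightarrow> \<phi> y = y"
    and E_sub: "E' \<subseteq> E"
    and E_id: "identifies (\<lambda>x. relation_ideal B E' +>\<^bsub>B\<^esub> \<phi> x) E"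
    and phi_cong: "\<And>x. x \<in> carrier A \<Longrightarrow> relation_ideal A E +>\<^bsub>A\<^esub> \<phi> x = relation_ideal A E +>\<^bsub>A\<^esub> x"
    and smult: "\<And>c. c \<odot>\<^bsub>A\<^esub> \<one>\<^bsub>A\<^esub> \<in> carrier A" "\<And>c. \<phi> (c \<odot>\<^bsub>A\<^esub> \<one>\<^bsub>A\<^esub>) = c \<odot>\<^bsub>B\<^esub> \<one>\<^bsub>B\<^esub>"
    and even: "even_part A \<subseteq> carrier A" "\<phi> ` even_part A = even_part B"
    and odd: "odd_part A \<subseteq> carrier A" "\<phi> ` odd_part A = odd_part B"
  shows "\<exists>h \<in> superalgebra_iso (quotient_superalgebra A E) (quotient_superalgebra B E').
    \<forall>x\<in>carrier A. h (relation_ideal A E +>\<^bsub>A\<^esub> x) = relation_ideal B E' +>\<^bsub>B\<^esub> \<phi> x"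
proof -
  interpret A: ring A by (rule A)
  interpret B: ring B by (rule B)
  define I J where "I = relation_ideal A E" and "J = relation_ideal B E'"
  interpret I: ideal I A unfolding I_def by (rule A.relation_ideal_ideal[OF E])
  interpret J: ideal J B unfolding J_def by (rule B.relation_ideal_ideal[OF E'])
  interpret QA: ring "A Quot I" by (rule I.quotient_is_ring)
  interpret QB: ring "B Quot J" by (rule J.quotient_is_ring)
  define g where "g x = J +>\<^bsub>B\<^esub> \<phi> x" for x
  interpret g: ring_hom_ring A "B Quot J" g
  proof (rule ring_hom_ringI2[OF A QB.ring_axioms])
    show "g \<in> ring_hom A (B Quot J)"
      using ring_hom_trans[OF hom J.rcos_ring_hom] by (simp add: comp_def g_def[abs_def])
  qed
  \<comment> \<open>The inclusion of \<open>B\<close> followed by the quotient map of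
    \<open>A\<close>; it kills the ideal of \<open>E'\<close> and so carries membership in
    \<open>J\<close> over to \<open>I\<close>.\<close>
  interpret i: ring_hom_ring B "A Quot I" "\<lambda>x. I +>\<^bsub>A\<^esub> x"
  proof (rule ring_hom_ringI2[OF B QA.ring_axioms])
    show "(\<lambda>x. I +>\<^bsub>A\<^esub> x) \<in> ring_hom B (A Quot I)"
      using ring_hom_trans[OF incl I.rcos_ring_hom] by (simp add: comp_def)
  qed
  have phi: "\<phi> x \<in> carrier B" if "x \<in> carrier A" for x
    using hom that by (rule ring_hom_closed)
  have BA: "y \<in> carrier A" if "y \<in> carrier B" for y
    using incl that by (rule ring_hom_closed)
  have zero: "\<zero>\<^bsub>A Quot I\<^esub> = I" "\<zero>\<^bsub>B Quot J\<^esub> = J"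
    by (simp_all add: FactRing_def)
  have ker: "a_kernel A (B Quot J) g = I"
  proof (intro equalityI subsetI)
    fix x assume "x \<in> a_kernel A (B Quot J) g"
    then have x: "x \<in> carrier A" and "J +>\<^bsub>B\<^esub> \<phi> x = J"
      unfolding a_kernel_def' by (simp_all add: g_def zero)
    then have "\<phi> x \<in> J"
      using phi J.rcos_const_imp_mem by blast
    then have "I +>\<^bsub>A\<^esub> \<phi> x = I"
      using i.relation_ideal_kernel[OF E' identifies_mono[OF A.relation_ideal_identifies[OF E] E_sub, folded I_def]]
      by (simp add: J_def zero)
    then have "I +>\<^bsub>A\<^esub> x = I"
      using phi_cong[OF x] by (simp add: I_def)
    then show "x \<in> I" using x I.rcos_const_imp_mem by blast
  next
    fix x assume x: "x \<in> I"
    then have "g x = \<zero>\<^bsub>B Quot J\<^esub>"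
      using g.relation_ideal_kernel[OF E] E_id unfolding I_def J_def g_def by blast
    then show "x \<in> a_kernel A (B Quot J) g"
      unfolding a_kernel_def' using x I.Icarr by blast
  qed
  have carrier_A: "carrier (A Quot I) = (\<lambda>x. I +>\<^bsub>A\<^esub> x) ` carrier A"
    and carrier_B: "carrier (B Quot J) = (\<lambda>x. J +>\<^bsub>B\<^esub> x) ` carrier B"
    by (auto simp: FactRing_def A_RCOSETS_def')
  have surj: "g ` carrier A = carrier (B Quot J)"
  proof
    show "g ` carrier A \<subseteq> carrier (B Quot J)" by auto
    show "carrier (B Quot J) \<subseteq> g ` carrier A"
    proof
      fix C assume "C \<in> carrier (B Quot J)"
      then obtain y where "y \<in> carrier B" "C = J +>\<^bsub>B\<^esub> y" unfolding carrier_B by blast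
      then show "C \<in> g ` carrier A" using retract BA by (intro image_eqI[of _ _ y]) (auto simp: g_def)
    qed
  qed
  \<comment> \<open>The representative-free form of the induced map: \<open>g\<close> is constant on
    each coset of its kernel.\<close>
  define h where "h X = the_elem (g ` X)" for X
  have h_iso: "h \<in> ring_iso (A Quot I) (B Quot J)"
    using g.FactRing_iso_set[OF surj] unfolding ker h_def[abs_def] .
  have h: "h (I +>\<^bsub>A\<^esub> x) = J +>\<^bsub>B\<^esub> \<phi> x" if "x \<in> carrier A" for x
    using g.the_elem_simp[OF that] unfolding ker h_def g_def .
  let ?QA = "quotient_superalgebra A E" and ?QB = "quotient_superalgebra B E'"
  have iso: "h \<in> ring_iso ?QA ?QB"
    using h_iso unfolding ring_iso_def ring_hom_def quotient_superalgebra_def Let_def I_def J_def by simp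
  \<comment> \<open>A scalar acts on a quotient as multiplication by the class of its multiple of
    one, so linearity follows from multiplicativity and the values of \<open>\<phi>\<close> on such
    multiples.\<close>
  have "h (c \<odot>\<^bsub>?QA\<^esub> C) = c \<odot>\<^bsub>?QB\<^esub> h C" if "C \<in> carrier ?QA" for c C
  proof -
    have C: "C \<in> carrier (A Quot I)"
      using that by (simp add: quotient_superalgebra_def Let_def I_def)
    have c: "I +>\<^bsub>A\<^esub> (c \<odot>\<^bsub>A\<^esub> \<one>\<^bsub>A\<^esub>) \<in> carrier (A Quot I)"
      unfolding carrier_A using smult(1) by blast
    have "h ((I +>\<^bsub>A\<^esub> (c \<odot>\<^bsub>A\<^esub> \<one>\<^bsub>A\<^esub>)) \<otimes>\<^bsub>A Quot I\<^esub> C) =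
        (J +>\<^bsub>B\<^esub> (c \<odot>\<^bsub>B\<^esub> \<one>\<^bsub>B\<^esub>)) \<otimes>\<^bsub>B Quot J\<^esub> h C"
      using ring_iso_memE(2)[OF h_iso c C] h[OF smult(1)] smult(2) by simp
    then show ?thesis
      by (simp add: quotient_superalgebra_def Let_def I_def J_def)
  qed
  moreover have "h ` even_part ?QA = even_part ?QB"
  proof -
    have "h ` (+>\<^bsub>A\<^esub>) I ` even_part A = (+>\<^bsub>B\<^esub>) J ` \<phi> ` even_part A"
      unfolding image_image using even(1) h by (intro image_cong) auto
    then show ?thesis
      by (simp add: quotient_superalgebra_def Let_def I_def J_def even)
  qed
  moreover have "h ` odd_part ?QA = odd_part ?QB"
  proof -
    have "h ` (+>\<^bsub>A\<^esub>) I ` odd_part A = (+>\<^bsub>B\<^esub>) J ` \<phi> ` odd_part A"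
      unfolding image_image using odd(1) h by (intro image_cong) auto
    then show ?thesis
      by (simp add: quotient_superalgebra_def Let_def I_def J_def odd)
  qed
  ultimately have "h \<in> superalgebra_iso ?QA ?QB"
    using iso unfolding superalgebra_iso_def by blast
  then show ?thesis using h unfolding I_def J_def by blast
qed

section \<open>Free superalgebras and presentations\<close>

definition free_carrier :: "'g set \<Rightarrow> ('g, 'k::field) free_algebra set" where
  "free_carrier X = {f. \<forall>w\<in>Poly_Mapping.keys f. set (letters w) \<subseteq> X}"

lemma free_superalgebra_simps [simp]:
  "carrier (free_superalgebra X p) = free_carrier X"
  "f \<otimes>\<^bsub>free_superalgebra X p\<^esub> g = f * g"
  "f \<oplus>\<^bsub>free_superalgebra X p\<^esub> g = f + g"
  "\<one>\<^bsub>free_superalgebra X p\<^esub> = 1"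
  "\<zero>\<^bsub>free_superalgebra X p\<^esub> = 0"
  "c \<odot>\<^bsub>free_superalgebra X p\<^esub> f = const c * f"
  by (simp_all add: free_superalgebra_def Let_def free_carrier_def)

text \<open>A Boolean parity treats the even and the odd part at once; parities add as exclusive or,
  written \<open>\<noteq>\<close> in \<open>homogeneous_mult\<close>.\<close>

definition homogeneous :: "'g set \<Rightarrow> ('g \<Rightarrow> bool) \<Rightarrow> bool \<Rightarrow> ('g, 'k::field) free_algebra set" where
  "homogeneous X p b =
    {f. \<forall>w\<in>Poly_Mapping.keys f. set (letters w) \<subseteq> X \<and> word_odd p w = b}"

lemma free_superalgebra_parts:
  "even_part (free_superalgebra X p) = homogeneous X p False"
  "odd_part (free_superalgebra X p) = homogeneous X p True"
  by (auto simp: free_superalgebra_def Let_def homogeneous_def free_carrier_def)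

lemma homogeneous_carrier: "homogeneous X p b \<subseteq> free_carrier X"
  by (auto simp: homogeneous_def free_carrier_def)

lemma letters_plus [simp]: "letters (v + w) = letters v @ letters w"
  by (simp add: plus_free_monoid_def)

lemma letters_zero [simp]: "letters 0 = []"
  by (simp add: zero_free_monoid_def)

lemma free_carrier_add: "\<lbrakk>f \<in> free_carrier X; g \<in> free_carrier X\<rbrakk> \<Longrightarrow> f + g \<in> free_carrier X"
  using keys_add[of f g] unfolding free_carrier_def by blast

lemma free_carrier_mult:
  assumes "f \<in> free_carrier X" "g \<in> free_carrier X"
  shows "f * g \<in> free_carrier X"
proof -
  have "set (letters w) \<subseteq> X" if w: "w \<in> Poly_Mapping.keys (f * g)" for w
  proof -
    obtain a b where "w = a + b" "a \<in> Poly_Mapping.keys f" "b \<in> Poly_Mapping.keys g"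
      using subsetD[OF keys_mult w] by blast
    then show ?thesis using assms by (auto simp: free_carrier_def)
  qed
  then show ?thesis unfolding free_carrier_def by blast
qed

lemma keys_uminus: "Poly_Mapping.keys (- f :: 'a \<Rightarrow>\<^sub>0 'b::ab_group_add) = Poly_Mapping.keys f"
  by (auto simp: in_keys_iff)

lemma free_carrier_uminus: "f \<in> free_carrier X \<Longrightarrow> - f \<in> free_carrier X"
  by (simp add: free_carrier_def keys_uminus)

lemma free_carrier_const: "const c \<in> free_carrier X"
  by (simp add: free_carrier_def const_def)

lemma free_carrier_zero: "0 \<in> free_carrier X"
  by (simp add: free_carrier_def)

lemma free_carrier_one: "1 \<in> free_carrier X"
  by (simp add: free_carrier_def)

lemma free_carrier_gen: "x \<in> X \<Longrightarrow> gen x \<in> free_carrier X"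
  by (simp add: free_carrier_def gen_def)

lemmas free_carrier_closed [simp] = free_carrier_zero free_carrier_add free_carrier_mult free_carrier_uminus
  free_carrier_const free_carrier_one free_carrier_gen

lemma free_carrier_mono: "X \<subseteq> Y \<Longrightarrow> free_carrier X \<subseteq> free_carrier Y"
  unfolding free_carrier_def by blast

lemma ring_free_superalgebra: "ring (free_superalgebra X p)"
proof (rule ringI)
  show "abelian_group (free_superalgebra X p)"
  proof (rule abelian_groupI)
    fix f assume f: "f \<in> carrier (free_superalgebra X p)"
    show "\<exists>g\<in>carrier (free_superalgebra X p). g \<oplus>\<^bsub>free_superalgebra X p\<^esub> f = \<zero>\<^bsub>free_superalgebra X p\<^esub>"
      using f by (intro bexI[of _ "- f"]) auto
  qed (simp_all add: add.assoc add.commute)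
  show "monoid (free_superalgebra X p)"
    by (rule monoidI) (simp_all add: mult.assoc)
qed (simp_all add: algebra_simps)

text \<open>Uniqueness of additive inverses ties the negative of the ring structure, which depends
  on the carrier, to the negative of the underlying type.\<close>

lemma free_a_inv:
  assumes "f \<in> free_carrier X" shows "\<ominus>\<^bsub>free_superalgebra X p\<^esub> f = - f"
proof -
  interpret ring "free_superalgebra X p" by (rule ring_free_superalgebra)
  show ?thesis using assms free_carrier_uminus[OF assms] by (intro minus_equality) auto
qed

section \<open>Parity in the free algebra\<close>

lemma homogeneous_zero: "0 \<in> homogeneous X p b"
  by (simp add: homogeneous_def)

lemma homogeneous_add:
  "\<lbrakk>f \<in> homogeneous X p b; g \<in> homogeneous X p b\<rbrakk> \<Longrightarrow> f + g \<in> homogeneous X p b"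
  using keys_add[of f g] unfolding homogeneous_def by blast

lemma homogeneous_uminus: "f \<in> homogeneous X p b \<Longrightarrow> - f \<in> homogeneous X p b"
  by (simp add: homogeneous_def keys_uminus)

lemma homogeneous_sum:
  "(\<And>i. i \<in> I \<Longrightarrow> f i \<in> homogeneous X p b) \<Longrightarrow> sum f I \<in> homogeneous X p b"
  by (induction I rule: infinite_finite_induct) (auto intro: homogeneous_add homogeneous_zero)

lemma homogeneous_mult:
  assumes "f \<in> homogeneous X p b" "g \<in> homogeneous X p b'"
  shows "f * g \<in> homogeneous X p (b \<noteq> b')"
proof -
  have "set (letters w) \<subseteq> X \<and> word_odd p w = (b \<noteq> b')" if w: "w \<in> Poly_Mapping.keys (f * g)" for w
  proof -
    obtain a b where "w = a + b" "a \<in> Poly_Mapping.keys f" "b \<in> Poly_Mapping.keys g"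
      using subsetD[OF keys_mult w] by blast
    then show ?thesis using assms by (auto simp: homogeneous_def word_odd_def)
  qed
  then show ?thesis by (simp add: homogeneous_def)
qed

lemma homogeneous_const: "const c \<in> homogeneous X p False"
  by (simp add: homogeneous_def const_def word_odd_def)

lemma homogeneous_gen: "x \<in> X \<Longrightarrow> gen x \<in> homogeneous X p (p x)"
  by (simp add: homogeneous_def gen_def word_odd_def)

section \<open>Monomials and induction on elements\<close>

lemma single_Cons: "Poly_Mapping.single (Word (x # ws)) c = gen x * Poly_Mapping.single (Word ws) c"
  by (simp add: gen_def mult_single plus_free_monoid_def)

lemma sum_single: "f = (\<Sum>w\<in>Poly_Mapping.keys f. Poly_Mapping.single w (Poly_Mapping.lookup f w))"
  by (rule poly_mapping_eqI) (auto simp: lookup_sum lookup_single when_def in_keys_iff)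

lemma const_commute: "const c * f = f * const c"
  unfolding const_def
  by (subst (1 2) sum_single)
    (simp add: sum_distrib_left sum_distrib_right mult_single mult.commute)

text \<open>An element is a finite sum of monomials, and a monomial arises from a scalar by
  attaching letters on the left. The step for products therefore needs only a generator as left
  factor.\<close>

lemma free_algebra_induct [consumes 1, case_names const gen add]:
  assumes f: "f \<in> free_carrier X"
    and const: "\<And>c. P (const c)"
    and gen: "\<And>x f. \<lbrakk>x \<in> X; f \<in> free_carrier X; P f\<rbrakk> \<Longrightarrow> P (gen x * f)"
    and add: "\<And>f g. \<lbrakk>f \<in> free_carrier X; g \<in> free_carrier X; P f; P g\<rbrakk> \<Longrightarrow> P (f + g)"
  shows "P f"
proof -
  have word: "P (Poly_Mapping.single (Word ws) c)" if "set ws \<subseteq> X" for ws c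
    using that
  proof (induction ws)
    case Nil
    then show ?case using const[of c] by (simp add: const_def zero_free_monoid_def)
  next
    case (Cons x ws)
    then show ?case unfolding single_Cons by (intro gen) (auto simp: free_carrier_def)
  qed
  \<comment> \<open>Partial sums over subsets of the support; membership in the carrier is carried
    along because the hypothesis \<open>add\<close> demands it.\<close>
  have "P (\<Sum>w\<in>W. Poly_Mapping.single w (Poly_Mapping.lookup f w)) \<and>
      (\<Sum>w\<in>W. Poly_Mapping.single w (Poly_Mapping.lookup f w)) \<in> free_carrier X"
    if "finite W" "W \<subseteq> Poly_Mapping.keys f" for W
    using that
  proof (induction W)
    case empty
    then show ?case using const[of 0] by (simp add: const_def)
  next
    case (insert w W)
    have w: "set (letters w) \<subseteq> X" using insert.prems f by (auto simp: free_carrier_def)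
    then have "P (Poly_Mapping.single w (Poly_Mapping.lookup f w))"
      using word[of "letters w"] by simp
    moreover have "Poly_Mapping.single w (Poly_Mapping.lookup f w) \<in> free_carrier X"
      using w by (simp add: free_carrier_def)
    ultimately show ?case
      using insert by (simp add: add)
  qed
  from this[of "Poly_Mapping.keys f"] show ?thesis
    by (simp flip: sum_single)
qed

section \<open>Substitution for the generators\<close>

definition subst :: "('g \<Rightarrow> ('h, 'k) free_algebra) \<Rightarrow> ('g, 'k::field) free_algebra \<Rightarrow> ('h, 'k) free_algebra" where
  "subst \<sigma> f =
    (\<Sum>w\<in>Poly_Mapping.keys f. const (Poly_Mapping.lookup f w) * prod_list (map \<sigma> (letters w)))"

lemma const_0 [simp]: "const 0 = 0" by (simp add: const_def)

lemma const_1 [simp]: "const 1 = 1" by (simp add: const_def)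

lemma const_add: "const (a + b) = const a + const b" by (simp add: const_def single_add)

lemma const_mult: "const (a * b) = const a * const b" by (simp add: const_def mult_single)

text \<open>Words outside the support contribute zero, so two elements can be summed over the union
  of their supports.\<close>

lemma subst_superset:
  assumes "finite W" "Poly_Mapping.keys f \<subseteq> W"
  shows "subst \<sigma> f = (\<Sum>w\<in>W. const (Poly_Mapping.lookup f w) * prod_list (map \<sigma> (letters w)))"
  unfolding subst_def using assms by (intro sum.mono_neutral_left) (auto simp: in_keys_iff)

lemma subst_single: "subst \<sigma> (Poly_Mapping.single w c) = const c * prod_list (map \<sigma> (letters w))"
  by (simp add: subst_superset[of "{w}"])

lemma subst_const [simp]: "subst \<sigma> (const c) = const c"
  by (simp add: const_def subst_single[of _ 0, simplified const_def, simplified])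

lemma subst_gen [simp]: "subst \<sigma> (gen x) = \<sigma> x"
  by (simp add: gen_def subst_single)

lemma subst_zero [simp]: "subst \<sigma> 0 = 0"
  by (simp add: subst_def)

lemma subst_one [simp]: "subst \<sigma> 1 = 1"
  using subst_const[of \<sigma> 1] by simp

lemma subst_add: "subst \<sigma> (f + g) = subst \<sigma> f + subst \<sigma> g"
proof -
  let ?W = "Poly_Mapping.keys f \<union> Poly_Mapping.keys g"
  have "finite ?W" "Poly_Mapping.keys (f + g) \<subseteq> ?W" by (simp_all add: keys_add)
  then show ?thesis
    by (simp add: subst_superset[of ?W] lookup_add const_add distrib_right sum.distrib)
qed

lemma subst_sum: "subst \<sigma> (sum f I) = (\<Sum>i\<in>I. subst \<sigma> (f i))"
  by (induction I rule: infinite_finite_induct) (simp_all add: subst_add)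

lemma subst_uminus: "subst \<sigma> (- f) = - subst \<sigma> f"
  using subst_add[of \<sigma> f "- f"] by (simp add: eq_neg_iff_add_eq_0 add.commute)

text \<open>By bilinearity it suffices to treat monomials, where the scalar of the second factor has
  to move past the value of the first word.\<close>

lemma subst_mult: "subst \<sigma> (f * g) = subst \<sigma> f * subst \<sigma> g"
proof -
  let ?s = "\<lambda>f w. Poly_Mapping.single w (Poly_Mapping.lookup f w)"
  have "subst \<sigma> (?s f v * ?s g w) = subst \<sigma> (?s f v) * subst \<sigma> (?s g w)" for v w
  proof -
    let ?a = "Poly_Mapping.lookup f v" and ?b = "Poly_Mapping.lookup g w"
    let ?v = "prod_list (map \<sigma> (letters v))" and ?w = "prod_list (map \<sigma> (letters w))"
    have "const ?a * const ?b * (?v * ?w) = const ?a * (const ?b * ?v) * ?w"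
      by (simp only: mult.assoc)
    also have "const ?b * ?v = ?v * const ?b" by (rule const_commute)
    finally show ?thesis by (simp add: mult_single subst_single const_mult mult.assoc)
  qed
  then have "subst \<sigma> ((\<Sum>v\<in>Poly_Mapping.keys f. ?s f v) * (\<Sum>w\<in>Poly_Mapping.keys g. ?s g w)) =
      subst \<sigma> (\<Sum>v\<in>Poly_Mapping.keys f. ?s f v) * subst \<sigma> (\<Sum>w\<in>Poly_Mapping.keys g. ?s g w)"
    by (simp add: sum_product subst_sum)
  then show ?thesis by (simp flip: sum_single)
qed

lemma subst_carrier:
  assumes "f \<in> free_carrier X" and "\<And>x. x \<in> X \<Longrightarrow> \<sigma> x \<in> free_carrier Y"
  shows "subst \<sigma> f \<in> free_carrier Y"
  using assms(1)
  by (induction rule: free_algebra_induct)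
    (simp_all only: subst_const subst_mult subst_gen subst_add free_carrier_closed assms(2))

lemma subst_ident:
  assumes "f \<in> free_carrier X" and "\<And>x. x \<in> X \<Longrightarrow> \<sigma> x = gen x"
  shows "subst \<sigma> f = f"
  using assms(1)
  by (induction rule: free_algebra_induct) (simp_all add: subst_mult subst_add assms(2))

lemma subst_homogeneous:
  assumes f: "f \<in> homogeneous X p b" and \<sigma>: "\<And>x. x \<in> X \<Longrightarrow> \<sigma> x \<in> homogeneous Y q (p x)"
  shows "subst \<sigma> f \<in> homogeneous Y q b"
proof -
  have word: "prod_list (map \<sigma> ws) \<in> homogeneous Y q (odd (length (filter p ws)))"
    if "set ws \<subseteq> X" for ws
    using that
  proof (induction ws)
    case Nil
    then show ?case using homogeneous_const[of 1] by simp
  next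
    case (Cons x ws)
    then have "\<sigma> x * prod_list (map \<sigma> ws) \<in> homogeneous Y q (p x \<noteq> odd (length (filter p ws)))"
      by (intro homogeneous_mult \<sigma>) auto
    moreover have "(p x \<noteq> odd (length (filter p ws))) = odd (length (filter p (x # ws)))"
      by simp
    ultimately show ?case by (simp only: list.map prod_list.Cons)
  qed
  have "const (Poly_Mapping.lookup f w) * prod_list (map \<sigma> (letters w)) \<in> homogeneous Y q b"
    if "w \<in> Poly_Mapping.keys f" for w
  proof -
    have "set (letters w) \<subseteq> X" "word_odd p w = b"
      using f that by (auto simp: homogeneous_def)
    then show ?thesis
      using homogeneous_mult[OF homogeneous_const word, of "letters w"] by (simp add: word_odd_def)
  qed
  then show ?thesis unfolding subst_def by (rule homogeneous_sum)
qed

lemma subst_ring_hom: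
  assumes "\<And>x. x \<in> X \<Longrightarrow> \<sigma> x \<in> free_carrier Y"
  shows "subst \<sigma> \<in> ring_hom (free_superalgebra X p) (free_superalgebra Y q)"
  using subst_carrier[of _ X \<sigma> Y] assms by (intro ring_hom_memI) (auto simp: subst_add subst_mult)

section \<open>Algebras presented by generators and relations\<close>

locale presentation =
  fixes X :: "'g set" and p :: "'g \<Rightarrow> bool"
    and E :: "(('g, 'k::field) free_algebra \<times> ('g, 'k) free_algebra) set"
  assumes relations_carrier: "E \<subseteq> free_carrier X \<times> free_carrier X"
begin

abbreviation F :: "('k, ('g, 'k) free_algebra) superalgebra" where
  "F \<equiv> free_superalgebra X p"

abbreviation I :: "('g, 'k) free_algebra set" where
  "I \<equiv> relation_ideal F E"

abbreviation Q :: "('g, 'k) free_algebra set ring" where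
  "Q \<equiv> F Quot I"

abbreviation cls :: "('g, 'k) free_algebra \<Rightarrow> ('g, 'k) free_algebra set" where
  "cls f \<equiv> I +>\<^bsub>F\<^esub> f"

lemma relations: "E \<subseteq> carrier F \<times> carrier F"
  using relations_carrier by simp

lemma ideal: "ideal I F"
  using ring.relation_ideal_ideal[OF ring_free_superalgebra relations] .

lemma ring_Q: "ring Q"
  using ideal by (rule ideal.quotient_is_ring)

lemma cls_hom: "ring_hom_ring F Q cls"
  using ideal by (rule ideal.rcos_ring_hom_ring)

lemma cls_mult: "\<lbrakk>f \<in> free_carrier X; g \<in> free_carrier X\<rbrakk> \<Longrightarrow> cls (f * g) = cls f \<otimes>\<^bsub>Q\<^esub> cls g"
  using ring_hom_mult[OF ring_hom_ring.homh[OF cls_hom], of f g] by simp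

lemma cls_add: "\<lbrakk>f \<in> free_carrier X; g \<in> free_carrier X\<rbrakk> \<Longrightarrow> cls (f + g) = cls f \<oplus>\<^bsub>Q\<^esub> cls g"
  using ring_hom_add[OF ring_hom_ring.homh[OF cls_hom], of f g] by simp

lemma cls_one: "cls 1 = \<one>\<^bsub>Q\<^esub>"
  using ring_hom_one[OF ring_hom_ring.homh[OF cls_hom]] by simp

lemma cls_carrier: "f \<in> free_carrier X \<Longrightarrow> cls f \<in> carrier Q"
  using ring_hom_closed[OF ring_hom_ring.homh[OF cls_hom], of f] by simp

lemma cls_uminus:
  assumes "f \<in> free_carrier X" shows "cls (- f) = \<ominus>\<^bsub>Q\<^esub> cls f"
proof -
  interpret ring_hom_ring F Q cls by (rule cls_hom)
  show ?thesis using hom_a_inv[of f] assms by (simp add: free_a_inv)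
qed

lemma carrier_Q: "carrier Q = cls ` free_carrier X"
  by (auto simp: FactRing_def A_RCOSETS_def')

lemma identifies_relations: "identifies cls E"
  using ring.relation_ideal_identifies[OF ring_free_superalgebra relations] .

lemma relation: "(l, r) \<in> E \<Longrightarrow> cls l = cls r"
  using identifies_relations by (rule identifiesD)

text \<open>The elements commuting with a given class are closed under sums and products and contain
  the scalars, so generators suffice.\<close>

lemma cls_center:
  assumes z: "z \<in> free_carrier X"
    and comm: "\<And>x. x \<in> X \<Longrightarrow> cls z \<otimes>\<^bsub>Q\<^esub> cls (gen x) = cls (gen x) \<otimes>\<^bsub>Q\<^esub> cls z"
  shows "cls z \<in> center Q"
proof -
  interpret ring Q by (rule ring_Q)
  have "cls z \<otimes>\<^bsub>Q\<^esub> cls f = cls f \<otimes>\<^bsub>Q\<^esub> cls z" if "f \<in> free_carrier X" for f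
    using that
  proof (induction rule: free_algebra_induct)
    case (const c)
    have "cls (z * const c) = cls (const c * z)" by (simp add: const_commute)
    then show ?case by (simp only: cls_mult z free_carrier_const)
  next
    case (gen x f)
    have carr: "cls z \<in> carrier Q" "cls (Defs.gen x) \<in> carrier Q" "cls f \<in> carrier Q"
      using z gen.hyps by (simp_all add: cls_carrier)
    have "cls z \<otimes>\<^bsub>Q\<^esub> (cls (Defs.gen x) \<otimes>\<^bsub>Q\<^esub> cls f) = (cls z \<otimes>\<^bsub>Q\<^esub> cls (Defs.gen x)) \<otimes>\<^bsub>Q\<^esub> cls f"
      using carr by (simp only: m_assoc)
    also have "\<dots> = cls (Defs.gen x) \<otimes>\<^bsub>Q\<^esub> (cls z \<otimes>\<^bsub>Q\<^esub> cls f)"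
      using carr by (simp only: comm[OF gen.hyps(1)] m_assoc)
    also have "\<dots> = (cls (Defs.gen x) \<otimes>\<^bsub>Q\<^esub> cls f) \<otimes>\<^bsub>Q\<^esub> cls z"
      using carr by (simp only: gen.IH m_assoc)
    finally show ?case
      using gen.hyps by (simp only: cls_mult free_carrier_gen)
  next
    case (add f g)
    then show ?case
      using z by (simp only: cls_add cls_carrier l_distr r_distr)
  qed
  then show ?thesis using cls_carrier[OF z] by (auto simp: center_def carrier_Q)
qed

text \<open>Replacing each generator by an element congruent to it leaves all classes unchanged. For
  the elimination of \<open>S\<close> this gives the congruence hypothesis of the retraction
  argument.\<close>

lemma cls_subst:
  assumes "f \<in> free_carrier X" and \<sigma>: "\<And>x. x \<in> X \<Longrightarrow> \<sigma> x \<in> free_carrier X"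
    and eq: "\<And>x. x \<in> X \<Longrightarrow> cls (\<sigma> x) = cls (gen x)"
  shows "cls (subst \<sigma> f) = cls f"
  using assms(1)
  by (induction rule: free_algebra_induct)
    (simp_all only: subst_const subst_mult subst_gen subst_add cls_mult cls_add
      subst_carrier[OF _ \<sigma>] \<sigma> eq free_carrier_gen)

end

locale supercommutative_presentation = presentation +
  assumes supercommutation: "supercommutation X p \<subseteq> E"
begin

lemma cls_gen_commute:
  assumes "x \<in> X" "y \<in> X" "\<not> (p x \<and> p y)"
  shows "cls (gen x) \<otimes>\<^bsub>Q\<^esub> cls (gen y) = cls (gen y) \<otimes>\<^bsub>Q\<^esub> cls (gen x)"
proof -
  have "(gen x * gen y, (if p x \<and> p y then - 1 else 1) * (gen y * gen x)) \<in> E"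
    using supercommutation assms(1,2) unfolding supercommutation_def by blast
  then have "(gen x * gen y, gen y * gen x) \<in> E"
    using assms(3) by (simp only: if_False mult_1_left)
  then show ?thesis
    using relation assms(1,2) by (simp flip: cls_mult)
qed

lemma cls_gen_anticommute:
  assumes "x \<in> X" "y \<in> X" "p x" "p y"
  shows "cls (gen x) \<otimes>\<^bsub>Q\<^esub> cls (gen y) = \<ominus>\<^bsub>Q\<^esub> (cls (gen y) \<otimes>\<^bsub>Q\<^esub> cls (gen x))"
proof -
  have "(gen x * gen y, (if p x \<and> p y then - 1 else 1) * (gen y * gen x)) \<in> E"
    using supercommutation assms(1,2) unfolding supercommutation_def by blast
  then have "(gen x * gen y, - (gen y * gen x)) \<in> E"
    using assms(3,4) by (simp del: mult_minus_right mult_minus_left add: mult_minus1)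
  then show ?thesis
    using relation[of "gen x * gen y" "- (gen y * gen x)"] assms(1,2)
    by (simp add: cls_mult cls_uminus)
qed

lemma cls_gen_center: "\<lbrakk>x \<in> X; \<not> p x\<rbrakk> \<Longrightarrow> cls (gen x) \<in> center Q"
  by (intro cls_center cls_gen_commute) simp_all

text \<open>Moving an odd generator past two odd factors produces two signs, which cancel; an even
  generator commutes with each factor.\<close>

lemma cls_odd_gen_mult_center:
  assumes x: "x \<in> X" "p x" and y: "y \<in> X" "p y"
  shows "cls (gen x * gen y) \<in> center Q"
proof (rule cls_center)
  show "gen x * gen y \<in> free_carrier X" using x y by simp
next
  interpret ring Q by (rule ring_Q)
  fix z assume z: "z \<in> X"
  let ?x = "cls (gen x)" and ?y = "cls (gen y)" and ?z = "cls (gen z)"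
  have carr: "?x \<in> carrier Q" "?y \<in> carrier Q" "?z \<in> carrier Q"
    using x y z by (simp_all add: cls_carrier)
  have "(?x \<otimes>\<^bsub>Q\<^esub> ?y) \<otimes>\<^bsub>Q\<^esub> ?z = ?z \<otimes>\<^bsub>Q\<^esub> (?x \<otimes>\<^bsub>Q\<^esub> ?y)"
  proof (cases "p z")
    case False
    then show ?thesis
      using carr cls_gen_commute[OF x(1) z] cls_gen_commute[OF y(1) z]
      by (metis m_assoc)
  next
    case True
    have "(?x \<otimes>\<^bsub>Q\<^esub> ?y) \<otimes>\<^bsub>Q\<^esub> ?z = ?x \<otimes>\<^bsub>Q\<^esub> (\<ominus>\<^bsub>Q\<^esub> (?z \<otimes>\<^bsub>Q\<^esub> ?y))"
      using carr cls_gen_anticommute[OF y(1) z y(2) True] by (simp only: m_assoc)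
    also have "\<dots> = (\<ominus>\<^bsub>Q\<^esub> (?x \<otimes>\<^bsub>Q\<^esub> ?z)) \<otimes>\<^bsub>Q\<^esub> ?y"
      using carr by (simp add: m_assoc l_minus r_minus)
    also have "\<ominus>\<^bsub>Q\<^esub> (?x \<otimes>\<^bsub>Q\<^esub> ?z) = ?z \<otimes>\<^bsub>Q\<^esub> ?x"
      by (rule cls_gen_anticommute[OF z x(1) True x(2), symmetric])
    finally show ?thesis using carr by (simp only: m_assoc)
  qed
  then show "cls (gen x * gen y) \<otimes>\<^bsub>Q\<^esub> ?z = ?z \<otimes>\<^bsub>Q\<^esub> cls (gen x * gen y)"
    using x y by (simp add: cls_mult)
qed

end

lemma supercommutation_carrier: "supercommutation X p \<subseteq> free_carrier X \<times> free_carrier X"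
proof -
  have "(if b then - 1 else 1) * (gen y * gen x) \<in> free_carrier X" if "x \<in> X" "y \<in> X" for b x y
    using that by (cases b) simp_all
  then show ?thesis unfolding supercommutation_def by auto
qed

lemma supercommutation_mono: "X \<subseteq> Y \<Longrightarrow> supercommutation X p \<subseteq> supercommutation Y p"
  unfolding supercommutation_def by blast

section \<open>Elimination of the odd-odd components\<close>

text \<open>The lift of \<open>plucker_chart.S\<close> to the free algebra. The order of the factors
  is significant there, since commutation holds only after passing to the quotient.\<close>

definition S_poly :: "nat \<Rightarrow> nat \<Rightarrow> nat \<Rightarrow> nat \<Rightarrow> (generator, 'k::field) free_algebra" where
  "S_poly i j l k =
    - (gen (TinvG i j) * (Theta_gen i l * Theta_gen j k + Theta_gen i k * Theta_gen j l))"

definition eliminate_S :: "nat \<Rightarrow> nat \<Rightarrow> generator \<Rightarrow> (generator, 'k::field) free_algebra" where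
  "eliminate_S i j x = (case x of SG l k \<Rightarrow> S_poly i j l k | _ \<Rightarrow> gen x)"

text \<open>The pair \<open>i\<close>, \<open>j\<close> is any chosen element of \<open>D\<close>;
  the inverse of this single component is enough to eliminate all the \<open>S\<close>. The
  parameter \<open>k_type\<close> fixes the scalar field.\<close>

locale plucker_presentations =
  fixes n m :: nat and D :: "(nat \<times> nat) set" and i j :: nat and k_type :: "'k::field itself"
  assumes D: "D \<subseteq> {1..n} \<times> {1..n}" and ij: "(i, j) \<in> D"
begin

declare atLeastAtMost_iff [simp del] One_nat_def [simp del]

abbreviation "X\<^sub>F \<equiv> full_generators n m D"
abbreviation "X\<^sub>R \<equiv> reduced_generators n m D"
abbreviation "E\<^sub>F \<equiv> full_relations n m D :: ((generator, 'k) free_algebra \<times> _) set"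
abbreviation "E\<^sub>R \<equiv> reduced_relations n m D :: ((generator, 'k) free_algebra \<times> _) set"

section \<open>The two presentations compared\<close>

lemma i: "i \<in> {1..n}" and j: "j \<in> {1..n}"
  using D ij by auto

lemma subset: "X\<^sub>R \<subseteq> X\<^sub>F"
  by (simp add: full_generators_def)

lemma gens [simp]:
  "\<lbrakk>a \<in> {1..n}; b \<in> {1..n}\<rbrakk> \<Longrightarrow> TG a b \<in> X\<^sub>R"
  "\<lbrakk>a \<in> {1..n}; l \<in> {1..m}\<rbrakk> \<Longrightarrow> ThetaG a l \<in> X\<^sub>R"
  "(a, b) \<in> D \<Longrightarrow> TinvG a b \<in> X\<^sub>R"
  "\<lbrakk>a \<in> {1..n}; b \<in> {1..n}\<rbrakk> \<Longrightarrow> TG a b \<in> X\<^sub>F"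
  "\<lbrakk>a \<in> {1..n}; l \<in> {1..m}\<rbrakk> \<Longrightarrow> ThetaG a l \<in> X\<^sub>F"
  "(a, b) \<in> D \<Longrightarrow> TinvG a b \<in> X\<^sub>F"
  "\<lbrakk>l \<in> {1..m}; k \<in> {1..m}\<rbrakk> \<Longrightarrow> SG l k \<in> X\<^sub>F"
  unfolding full_generators_def reduced_generators_def by simp_all

lemma gen_carrier [simp]:
  "\<lbrakk>a \<in> {1..n}; b \<in> {1..n}\<rbrakk> \<Longrightarrow> T_gen a b \<in> free_carrier X\<^sub>R"
  "\<lbrakk>a \<in> {1..n}; l \<in> {1..m}\<rbrakk> \<Longrightarrow> Theta_gen a l \<in> free_carrier X\<^sub>R"
  "\<lbrakk>a \<in> {1..n}; b \<in> {1..n}\<rbrakk> \<Longrightarrow> T_gen a b \<in> free_carrier X\<^sub>F"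
  "\<lbrakk>a \<in> {1..n}; l \<in> {1..m}\<rbrakk> \<Longrightarrow> Theta_gen a l \<in> free_carrier X\<^sub>F"
  "\<lbrakk>l \<in> {1..m}; k \<in> {1..m}\<rbrakk> \<Longrightarrow> S_gen l k \<in> free_carrier X\<^sub>F"
  by (simp_all add: T_gen_def Theta_gen_def S_gen_def)

lemma inversion_carrier: "inversion D \<subseteq> free_carrier X\<^sub>R \<times> free_carrier X\<^sub>R"
proof -
  have "gen (TG a b) * gen (TinvG a b) \<in> free_carrier X\<^sub>R" if "(a, b) \<in> D" for a b
    using that D by (intro free_carrier_mult free_carrier_gen gens) auto
  then show ?thesis unfolding inversion_def by auto
qed

lemma full_relations_carrier: "E\<^sub>F \<subseteq> free_carrier X\<^sub>F \<times> free_carrier X\<^sub>F"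
proof -
  interpret ring "full_free n m D" by (rule ring_free_superalgebra)
  have "S_symmetry m S_gen \<subseteq> free_carrier X\<^sub>F \<times> free_carrier X\<^sub>F"
    unfolding S_symmetry_def using gen_carrier(5) by blast
  moreover have "inversion D \<subseteq> free_carrier X\<^sub>F \<times> free_carrier X\<^sub>F"
    using inversion_carrier free_carrier_mono[OF subset] by blast
  moreover have "T_symmetry (full_free n m D) n T_gen \<subseteq> free_carrier X\<^sub>F \<times> free_carrier X\<^sub>F"
    using T_symmetry_carrier[of n T_gen] by simp
  moreover have "super_plucker (full_free n m D) n m T_gen Theta_gen S_gen
      \<subseteq> free_carrier X\<^sub>F \<times> free_carrier X\<^sub>F"
    using super_plucker_carrier[of n T_gen m Theta_gen S_gen] by simp
  ultimately show ?thesis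
    unfolding full_relations_def using supercommutation_carrier by blast
qed

lemma reduced_relations_carrier: "E\<^sub>R \<subseteq> free_carrier X\<^sub>R \<times> free_carrier X\<^sub>R"
proof -
  interpret ring "reduced_free n m D" by (rule ring_free_superalgebra)
  have "T_symmetry (reduced_free n m D) n T_gen \<subseteq> free_carrier X\<^sub>R \<times> free_carrier X\<^sub>R"
    using T_symmetry_carrier[of n T_gen] by simp
  moreover have "reduced_super_plucker (reduced_free n m D) n m T_gen Theta_gen
      \<subseteq> free_carrier X\<^sub>R \<times> free_carrier X\<^sub>R"
    using reduced_super_plucker_carrier[of n T_gen m Theta_gen] by simp
  ultimately show ?thesis
    unfolding reduced_relations_def using supercommutation_carrier inversion_carrier by blast
qed

text \<open>The two systems are formed in free algebras with different carriers. Sums and products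
  are those of the type in both, and negatives agree on the generators involved.\<close>

lemma reduced_subset_full: "E\<^sub>R \<subseteq> E\<^sub>F"
proof -
  have "T_symmetry (reduced_free n m D) n T_gen = T_symmetry (full_free n m D) n T_gen"
    unfolding T_symmetry_def by (intro Collect_cong ex_cong1 rev_conj_cong refl) (simp add: free_a_inv)
  moreover have "reduced_super_plucker (reduced_free n m D) n m T_gen Theta_gen =
      reduced_super_plucker (full_free n m D) n m T_gen Theta_gen"
    unfolding reduced_super_plucker_def by simp
  ultimately show ?thesis
    unfolding reduced_relations_def full_relations_def super_plucker_def
    using supercommutation_mono[OF subset] by blast
qed

sublocale full: supercommutative_presentation X\<^sub>F odd_generator E\<^sub>F
  by unfold_locales (use full_relations_carrier in \<open>auto simp: full_relations_def\<close>)

sublocale red: supercommutative_presentation X\<^sub>R odd_generator E\<^sub>R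
  by unfold_locales (use reduced_relations_carrier in \<open>auto simp: reduced_relations_def\<close>)

section \<open>The chart in the reduced algebra\<close>

lemma reduced_relation_images:
  "satisfied (T_symmetry red.Q n (\<lambda>a b. red.cls (T_gen a b)))"
  "satisfied (reduced_super_plucker red.Q n m (\<lambda>a b. red.cls (T_gen a b)) (\<lambda>a l. red.cls (Theta_gen a l)))"
  "(a, b) \<in> D \<Longrightarrow> red.cls (gen (TG a b) * gen (TinvG a b)) = red.cls 1"
proof -
  interpret c: ring_hom_ring red.F red.Q red.cls by (rule red.cls_hom)
  have "T_symmetry red.F n T_gen \<subseteq> E\<^sub>R"
    "reduced_super_plucker red.F n m T_gen Theta_gen \<subseteq> E\<^sub>R" "inversion D \<subseteq> E\<^sub>R"
    unfolding reduced_relations_def by blast+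
  note id = this[THEN identifies_mono[OF red.identifies_relations]]
  show "satisfied (T_symmetry red.Q n (\<lambda>a b. red.cls (T_gen a b)))"
    using id(1) by (subst (asm) c.identifies_T_symmetry) simp_all
  show "satisfied (reduced_super_plucker red.Q n m (\<lambda>a b. red.cls (T_gen a b)) (\<lambda>a l. red.cls (Theta_gen a l)))"
    using id(2) by (subst (asm) c.identifies_reduced_super_plucker) simp_all
  show "red.cls (gen (TG a b) * gen (TinvG a b)) = red.cls 1" if "(a, b) \<in> D"
    using id(3) by (rule identifiesD) (use that in \<open>auto simp: inversion_def\<close>)
qed

text \<open>Supercommutation makes the classes of even generators central and those of odd ones
  anticommute; the inversion relation makes the class of \<open>TinvG i j\<close> the required
  inverse.\<close>

sublocale chart: plucker_chart red.Q n m "\<lambda>a b. red.cls (T_gen a b)" "\<lambda>a l. red.cls (Theta_gen a l)"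
  i j "red.cls (gen (TinvG i j))"
proof (intro plucker_chart.intro plucker_chart_axioms.intro)
  show "ring red.Q" by (rule red.ring_Q)
  show "red.cls (T_gen a b) \<in> center red.Q" if "a \<in> {1..n}" "b \<in> {1..n}" for a b
    unfolding T_gen_def using that by (intro red.cls_gen_center) simp_all
  show "red.cls (Theta_gen a l) \<in> carrier red.Q" if "a \<in> {1..n}" "l \<in> {1..m}" for a l
    using that by (simp add: red.cls_carrier)
  show "red.cls (Theta_gen a l) \<otimes>\<^bsub>red.Q\<^esub> red.cls (Theta_gen b k) =
      \<ominus>\<^bsub>red.Q\<^esub> (red.cls (Theta_gen b k) \<otimes>\<^bsub>red.Q\<^esub> red.cls (Theta_gen a l))"
    if "a \<in> {1..n}" "l \<in> {1..m}" "b \<in> {1..n}" "k \<in> {1..m}" for a l b k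
    unfolding Theta_gen_def using that by (intro red.cls_gen_anticommute) simp_all
  show "red.cls (T_gen a b) = \<ominus>\<^bsub>red.Q\<^esub> red.cls (T_gen b a)" if "a \<in> {1..n}" "b \<in> {1..n}" for a b
    using reduced_relation_images(1) that unfolding T_symmetry_def satisfied_two by blast
  show "red.cls (gen (TinvG i j)) \<in> center red.Q"
    using ij by (intro red.cls_gen_center) simp_all
  show "red.cls (T_gen i j) \<otimes>\<^bsub>red.Q\<^esub> red.cls (gen (TinvG i j)) = \<one>\<^bsub>red.Q\<^esub>"
    using reduced_relation_images(3)[OF ij] ij i j
    by (simp add: red.cls_mult red.cls_one T_gen_def)
qed (fact reduced_relation_images i j)+

section \<open>The substitution that eliminates the odd-odd components\<close>

abbreviation "\<sigma> \<equiv> eliminate_S i j :: _ \<Rightarrow> (generator, 'k) free_algebra"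

lemma \<sigma>_simps [simp]: "\<sigma> (TG a b) = gen (TG a b)" "\<sigma> (ThetaG a l) = gen (ThetaG a l)"
    "\<sigma> (TinvG a b) = gen (TinvG a b)" "\<sigma> (SG l k) = S_poly i j l k"
  by (simp_all add: eliminate_S_def)

lemma S_poly_homogeneous:
  assumes "l \<in> {1..m}" "k \<in> {1..m}"
  shows "S_poly i j l k \<in> homogeneous X\<^sub>R odd_generator False"
proof -
  have \<theta>: "Theta_gen a l \<in> homogeneous X\<^sub>R odd_generator True" if "a \<in> {1..n}" "l \<in> {1..m}" for a l
    using homogeneous_gen[of "ThetaG a l" X\<^sub>R odd_generator] that by (simp add: Theta_gen_def)
  have "Theta_gen i l * Theta_gen j k \<in> homogeneous X\<^sub>R odd_generator False"
    if "l \<in> {1..m}" "k \<in> {1..m}" for l k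
    using homogeneous_mult[OF \<theta> \<theta>] i j that by simp
  moreover have "gen (TinvG i j) \<in> homogeneous X\<^sub>R odd_generator False"
    using homogeneous_gen[of "TinvG i j" X\<^sub>R odd_generator] ij by simp
  ultimately show ?thesis
    unfolding S_poly_def using assms
    by (intro homogeneous_uminus homogeneous_mult[of "gen (TinvG i j)" _ _ False _ False, simplified]
      homogeneous_add)
qed

lemma full_generators_cases:
  assumes "x \<in> X\<^sub>F"
  obtains "x \<in> X\<^sub>R" "\<sigma> x = gen x" | l k where "x = SG l k" "l \<in> {1..m}" "k \<in> {1..m}"
  using assms unfolding full_generators_def reduced_generators_def by auto

lemma \<sigma>_homogeneous:
  assumes "x \<in> X\<^sub>F" shows "\<sigma> x \<in> homogeneous X\<^sub>R odd_generator (odd_generator x)"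
  using assms by (cases rule: full_generators_cases) (simp_all add: homogeneous_gen S_poly_homogeneous)

lemma \<sigma>_carrier: "x \<in> X\<^sub>F \<Longrightarrow> \<sigma> x \<in> free_carrier X\<^sub>R"
  using \<sigma>_homogeneous homogeneous_carrier by blast

lemma \<sigma>_reduced: "x \<in> X\<^sub>R \<Longrightarrow> \<sigma> x = gen x"
  unfolding reduced_generators_def by auto

lemma cls_S_poly:
  assumes "l \<in> {1..m}" "k \<in> {1..m}"
  shows "red.cls (S_poly i j l k) = chart.S l k"
  using assms i j ij unfolding S_poly_def chart.S_def chart.Z_def
  by (simp add: red.cls_uminus red.cls_mult red.cls_add)

text \<open>The image of \<open>SG l k\<close> is not a generator, so its centrality is derived from
  that of products of two odd classes.\<close>

lemma cls_\<sigma>_center: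
  assumes x: "x \<in> X\<^sub>F" "\<not> odd_generator x"
  shows "red.cls (\<sigma> x) \<in> center red.Q"
  using x(1)
proof (cases rule: full_generators_cases)
  case 1
  then show ?thesis using x red.cls_gen_center by simp
next
  case (2 l k)
  have \<theta>: "red.cls (Theta_gen i l) \<otimes>\<^bsub>red.Q\<^esub> red.cls (Theta_gen j k) \<in> center red.Q"
    if "l \<in> {1..m}" "k \<in> {1..m}" for l k
    using red.cls_odd_gen_mult_center[of "ThetaG i l" "ThetaG j k"] that i j
    by (simp add: Theta_gen_def red.cls_mult)
  have "chart.S l k \<in> center red.Q"
    unfolding chart.S_def chart.Z_def using 2 \<theta>
    by (intro chart.center_minus chart.center_mult[OF chart.u_center] chart.center_add) simp_all
  then show ?thesis using 2 by (simp add: cls_S_poly)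
qed

lemma eliminate_hom: "ring_hom_ring full.F red.Q (\<lambda>f. red.cls (subst \<sigma> f))"
proof (rule ring_hom_ringI2[OF ring_free_superalgebra red.ring_Q])
  show "(\<lambda>f. red.cls (subst \<sigma> f)) \<in> ring_hom full.F red.Q"
    using ring_hom_trans[OF subst_ring_hom[OF \<sigma>_carrier] ring_hom_ring.homh[OF red.cls_hom]]
    by (simp add: comp_def)
qed

text \<open>Two odd generators are fixed by the substitution and keep their sign rule; in every
  other case one of the two images is central.\<close>

lemma eliminate_supercommutation:
  "identifies (\<lambda>f. red.cls (subst \<sigma> f)) (supercommutation X\<^sub>F odd_generator)"
  unfolding supercommutation_def identifies_two
proof (intro ballI)
  fix x y assume x: "x \<in> X\<^sub>F" and y: "y \<in> X\<^sub>F"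
  let ?c = "if odd_generator x \<and> odd_generator y then - 1 else 1 :: (generator, 'k) free_algebra"
  show "red.cls (subst \<sigma> (gen x * gen y)) = red.cls (subst \<sigma> (?c * (gen y * gen x)))"
  proof (cases "odd_generator x \<and> odd_generator y")
    case True
    then have "x \<in> X\<^sub>R" "y \<in> X\<^sub>R"
      using x y by (auto elim!: full_generators_cases)
    then show ?thesis
      using True red.cls_gen_anticommute[of x y]
      by (simp add: subst_mult subst_uminus \<sigma>_reduced red.cls_mult red.cls_uminus)
  next
    case False
    then consider "\<not> odd_generator x" | "\<not> odd_generator y" by blast
    then have "red.cls (\<sigma> x) \<otimes>\<^bsub>red.Q\<^esub> red.cls (\<sigma> y) = red.cls (\<sigma> y) \<otimes>\<^bsub>red.Q\<^esub> red.cls (\<sigma> x)"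
    proof cases
      case 1
      show ?thesis
        by (rule chart.center_commute[OF cls_\<sigma>_center[OF x 1] red.cls_carrier[OF \<sigma>_carrier[OF y]]])
    next
      case 2
      show ?thesis
        by (rule chart.center_commute[OF cls_\<sigma>_center[OF y 2] red.cls_carrier[OF \<sigma>_carrier[OF x]], symmetric])
    qed
    then have "red.cls (subst \<sigma> (gen x * gen y)) = red.cls (subst \<sigma> (gen y * gen x))"
      using x y by (simp add: subst_mult red.cls_mult \<sigma>_carrier)
    then show ?thesis using False by (simp only: if_False mult_1_left)
  qed
qed

lemma subst_gens [simp]: "subst \<sigma> (T_gen a b) = T_gen a b" "subst \<sigma> (Theta_gen a l) = Theta_gen a l"
    "subst \<sigma> (S_gen l k) = S_poly i j l k"
  by (simp_all add: T_gen_def Theta_gen_def S_gen_def)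

text \<open>This makes the map from the full to the reduced algebra well defined. The relations
  involving \<open>S\<close> hold because the images of the \<open>SG l k\<close> are the elements
  \<open>chart.S l k\<close>.\<close>

lemma eliminate_relations: "identifies (\<lambda>f. red.cls (subst \<sigma> f)) E\<^sub>F"
proof -
  interpret g: ring_hom_ring full.F red.Q "\<lambda>f. red.cls (subst \<sigma> f)" by (rule eliminate_hom)
  have "identifies (\<lambda>f. red.cls (subst \<sigma> f)) (T_symmetry full.F n T_gen)"
    by (subst g.identifies_T_symmetry) (simp_all add: reduced_relation_images)
  moreover have "identifies (\<lambda>f. red.cls (subst \<sigma> f)) (S_symmetry m S_gen)"
    unfolding S_symmetry_def identifies_two using chart.S_sym by (simp add: cls_S_poly)
  moreover have "identifies (\<lambda>f. red.cls (subst \<sigma> f))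
      (super_plucker full.F n m T_gen Theta_gen S_gen)"
  proof -
    have "satisfied (super_plucker red.Q n m (\<lambda>a b. red.cls (T_gen a b))
        (\<lambda>a l. red.cls (Theta_gen a l)) (\<lambda>l k. red.cls (S_poly i j l k)))"
      using chart.satisfied_super_plucker_S by (subst satisfied_super_plucker_cong[OF cls_S_poly])
    then show ?thesis by (subst g.identifies_super_plucker) simp_all
  qed
  moreover have "identifies (\<lambda>f. red.cls (subst \<sigma> f)) (inversion D)"
    unfolding identifies_def inversion_def
    by (auto simp: subst_mult reduced_relation_images)
  ultimately show ?thesis
    unfolding full_relations_def identifies_Un using eliminate_supercommutation by blast
qed

text \<open>In the full algebra the third relation at \<open>i\<close>, \<open>j\<close> can be
  solved for \<open>S\<close>, which makes the formula hold there as well.\<close>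

lemma full_cls_S:
  assumes lk: "l \<in> {1..m}" "k \<in> {1..m}"
  shows "full.cls (S_poly i j l k) = full.cls (S_gen l k)"
proof -
  interpret Q: ring full.Q by (rule full.ring_Q)
  interpret c: ring_hom_ring full.F full.Q full.cls by (rule full.cls_hom)
  have "super_plucker full.F n m T_gen Theta_gen S_gen \<subseteq> E\<^sub>F"
    unfolding full_relations_def by blast
  then have "identifies full.cls (super_plucker full.F n m T_gen Theta_gen S_gen)"
    by (rule identifies_mono[OF full.identifies_relations])
  then have "satisfied (super_plucker full.Q n m (\<lambda>a b. full.cls (T_gen a b))
        (\<lambda>a l. full.cls (Theta_gen a l)) (\<lambda>l k. full.cls (S_gen l k)))"
    by (subst (asm) c.identifies_super_plucker) simp_all
  then have rel: "full.cls (T_gen i j) \<otimes>\<^bsub>full.Q\<^esub> full.cls (S_gen l k) =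
      (\<ominus>\<^bsub>full.Q\<^esub> (full.cls (Theta_gen i l) \<otimes>\<^bsub>full.Q\<^esub> full.cls (Theta_gen j k)))
      \<ominus>\<^bsub>full.Q\<^esub> (full.cls (Theta_gen i k) \<otimes>\<^bsub>full.Q\<^esub> full.cls (Theta_gen j l))"
    using i j lk unfolding satisfied_super_plucker by blast
  let ?t = "full.cls (T_gen i j)" and ?u = "full.cls (gen (TinvG i j))"
  have carr: "?t \<in> carrier full.Q" "?u \<in> carrier full.Q"
    and carr': "\<And>l k. \<lbrakk>l \<in> {1..m}; k \<in> {1..m}\<rbrakk> \<Longrightarrow> full.cls (S_gen l k) \<in> carrier full.Q"
    "\<And>a l. \<lbrakk>a \<in> {1..n}; l \<in> {1..m}\<rbrakk> \<Longrightarrow> full.cls (Theta_gen a l) \<in> carrier full.Q"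
    using i j ij by (simp_all add: full.cls_carrier)
  have "(gen (TG i j) * gen (TinvG i j), 1) \<in> E\<^sub>F"
    using ij unfolding full_relations_def inversion_def by blast
  then have "?t \<otimes>\<^bsub>full.Q\<^esub> ?u = \<one>\<^bsub>full.Q\<^esub>"
    using full.relation[of "gen (TG i j) * gen (TinvG i j)" 1] i j ij
    by (simp add: full.cls_mult full.cls_one T_gen_def)
  \<comment> \<open>The inversion relation puts the inverse on the right; solving from the left
    needs that the two even generators commute.\<close>
  then have ut: "?u \<otimes>\<^bsub>full.Q\<^esub> ?t = \<one>\<^bsub>full.Q\<^esub>"
    using full.cls_gen_commute[of "TG i j" "TinvG i j"] i j ij by (simp add: T_gen_def)
  have "full.cls (S_gen l k) = ?u \<otimes>\<^bsub>full.Q\<^esub> (?t \<otimes>\<^bsub>full.Q\<^esub> full.cls (S_gen l k))"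
    using carr carr' lk ut by (simp flip: Q.m_assoc)
  also have "\<dots> = full.cls (S_poly i j l k)"
    unfolding rel S_poly_def using carr carr' lk i j ij
    by (simp add: full.cls_uminus full.cls_mult full.cls_add Q.minus_eq Q.r_distr Q.r_minus Q.minus_add)
  finally show ?thesis by simp
qed

lemma subst_full_cls: "f \<in> free_carrier X\<^sub>F \<Longrightarrow> full.cls (subst \<sigma> f) = full.cls f"
proof (rule full.cls_subst)
  show "\<sigma> x \<in> free_carrier X\<^sub>F" if "x \<in> X\<^sub>F" for x
    using \<sigma>_carrier[OF that] free_carrier_mono[OF subset] by blast
  show "full.cls (\<sigma> x) = full.cls (gen x)" if "x \<in> X\<^sub>F" for x
    using that by (cases rule: full_generators_cases) (simp_all add: full_cls_S S_gen_def)
qed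

lemma subst_image_homogeneous:
  "subst \<sigma> ` homogeneous X\<^sub>F odd_generator b = homogeneous X\<^sub>R odd_generator b"
proof
  show "subst \<sigma> ` homogeneous X\<^sub>F odd_generator b \<subseteq> homogeneous X\<^sub>R odd_generator b"
    by (intro image_subsetI subst_homogeneous[of _ X\<^sub>F odd_generator]) (simp_all add: \<sigma>_homogeneous)
  have "f \<in> homogeneous X\<^sub>F odd_generator b" "subst \<sigma> f = f"
    if f: "f \<in> homogeneous X\<^sub>R odd_generator b" for f :: "(generator, 'k) free_algebra"
  proof -
    show "f \<in> homogeneous X\<^sub>F odd_generator b"
      using f subset unfolding homogeneous_def by blast
    show "subst \<sigma> f = f"
      using f homogeneous_carrier \<sigma>_reduced by (intro subst_ident) blast+
  qed
  then show "homogeneous X\<^sub>R odd_generator b \<subseteq> subst \<sigma> ` homogeneous X\<^sub>F odd_generator b"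
    by (metis image_eqI subsetI)
qed

text \<open>The retraction argument for \<open>subst \<sigma>\<close>. The value of the map is
  recorded on every class, so that its action on the generators can be read off.\<close>

lemma isomorphism:
  "\<exists>h \<in> superalgebra_iso (full_algebra n m D)
      (reduced_algebra n m D :: ('k, (generator, 'k) free_algebra set) superalgebra).
    \<forall>f\<in>free_carrier X\<^sub>F. h (full_class n m D f) = reduced_class n m D (subst \<sigma> f)"
  unfolding full_algebra_def reduced_algebra_def full_class_def reduced_class_def
    free_superalgebra_simps(1)[symmetric, of X\<^sub>F odd_generator]
proof (rule superalgebra_iso_of_retraction)
  show "ring full.F" "ring red.F" by (rule ring_free_superalgebra)+
  show "E\<^sub>F \<subseteq> carrier full.F \<times> carrier full.F" by (rule full.relations)
  show "E\<^sub>R \<subseteq> carrier red.F \<times> carrier red.F" by (rule red.relations)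
  show "(\<lambda>x. x) \<in> ring_hom red.F full.F"
    using free_carrier_mono[OF subset] by (intro ring_hom_memI) auto
  show "subst \<sigma> \<in> ring_hom full.F red.F" using \<sigma>_carrier by (rule subst_ring_hom)
  show "subst \<sigma> f = f" if "f \<in> carrier red.F" for f
    using that \<sigma>_reduced by (intro subst_ident[of f X\<^sub>R]) simp_all
  show "E\<^sub>R \<subseteq> E\<^sub>F" by (rule reduced_subset_full)
  show "identifies (\<lambda>f. red.cls (subst \<sigma> f)) E\<^sub>F" by (rule eliminate_relations)
  show "full.cls (subst \<sigma> f) = full.cls f" if "f \<in> carrier full.F" for f
    using that subst_full_cls by simp
  show "c \<odot>\<^bsub>full.F\<^esub> \<one>\<^bsub>full.F\<^esub> \<in> carrier full.F"
    "subst \<sigma> (c \<odot>\<^bsub>full.F\<^esub> \<one>\<^bsub>full.F\<^esub>) = c \<odot>\<^bsub>red.F\<^esub> \<one>\<^bsub>red.F\<^esub>" for c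
    by simp_all
  show "even_part full.F \<subseteq> carrier full.F" "odd_part full.F \<subseteq> carrier full.F"
    by (simp_all add: free_superalgebra_parts homogeneous_carrier)
  show "subst \<sigma> ` even_part full.F = even_part red.F" "subst \<sigma> ` odd_part full.F = odd_part red.F"
    by (simp_all add: free_superalgebra_parts subst_image_homogeneous)
qed

end

section \<open>Nilpotence with non-degeneracy, and the isomorphism for every nonempty
  localization\<close>

theorem theorem3:
  fixes n m :: nat
  shows
    "(\<forall>(A :: ('k::field_char_0, 'a) superalgebra) T \<theta> S.
        comm_superalgebra A \<longrightarrow> \<one>\<^bsub>A\<^esub> \<noteq> \<zero>\<^bsub>A\<^esub> \<longrightarrow>
        even_bivector_components A n m T \<theta> S \<longrightarrow>
        some_even_component_invertible A n m T S \<longrightarrow>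
        satisfied (super_plucker A n m T \<theta> S) \<longrightarrow>
        (\<forall>l\<in>{1..m}. \<forall>\<mu>\<in>{1..m}. nilpotent A (S l \<mu>)) \<and> nondegenerate A n T) \<and>
     (\<forall>D. D \<noteq> {} \<and> D \<subseteq> {1..n} \<times> {1..n} \<longrightarrow>
        (\<exists>h \<in> superalgebra_iso (full_algebra n m D)
                (reduced_algebra n m D :: ('k, (generator, 'k) free_algebra set) superalgebra).
           (\<forall>a\<in>{1..n}. \<forall>b\<in>{1..n}.
              h (full_class n m D (T_gen a b)) = reduced_class n m D (T_gen a b)) \<and>
           (\<forall>a\<in>{1..n}. \<forall>\<mu>\<in>{1..m}.
              h (full_class n m D (Theta_gen a \<mu>)) = reduced_class n m D (Theta_gen a \<mu>))))"
proof (rule conjI)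
  show "\<forall>(A :: ('k, 'a) superalgebra) T \<theta> S.
        comm_superalgebra A \<longrightarrow> \<one>\<^bsub>A\<^esub> \<noteq> \<zero>\<^bsub>A\<^esub> \<longrightarrow>
        even_bivector_components A n m T \<theta> S \<longrightarrow>
        some_even_component_invertible A n m T S \<longrightarrow>
        satisfied (super_plucker A n m T \<theta> S) \<longrightarrow>
        (\<forall>l\<in>{1..m}. \<forall>\<mu>\<in>{1..m}. nilpotent A (S l \<mu>)) \<and> nondegenerate A n T"
    by (intro allI impI) (rule comm_superalgebra.nilpotent_and_nondegenerate)
  show "\<forall>D. D \<noteq> {} \<and> D \<subseteq> {1..n} \<times> {1..n} \<longrightarrow>
        (\<exists>h \<in> superalgebra_iso (full_algebra n m D)
                (reduced_algebra n m D :: ('k, (generator, 'k) free_algebra set) superalgebra).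
           (\<forall>a\<in>{1..n}. \<forall>b\<in>{1..n}.
              h (full_class n m D (T_gen a b)) = reduced_class n m D (T_gen a b)) \<and>
           (\<forall>a\<in>{1..n}. \<forall>\<mu>\<in>{1..m}.
              h (full_class n m D (Theta_gen a \<mu>)) = reduced_class n m D (Theta_gen a \<mu>)))"
  proof (intro allI impI, elim conjE)
    fix D :: "(nat \<times> nat) set"
    assume "D \<noteq> {}" and D: "D \<subseteq> {1..n} \<times> {1..n}"
    \<comment> \<open>Any component inverted by \<open>D\<close> can serve as the chart.\<close>
    then obtain i j where ij: "(i, j) \<in> D" by auto
    interpret plucker_presentations n m D i j "TYPE('k)"
      using D ij by unfold_locales
    obtain h where h: "h \<in> superalgebra_iso (full_algebra n m D)
        (reduced_algebra n m D :: ('k, (generator, 'k) free_algebra set) superalgebra)"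
      and h_class: "\<And>f. f \<in> free_carrier X\<^sub>F \<Longrightarrow>
        h (full_class n m D f) = reduced_class n m D (subst \<sigma> f)"
      using isomorphism by blast
    show "\<exists>h \<in> superalgebra_iso (full_algebra n m D)
          (reduced_algebra n m D :: ('k, (generator, 'k) free_algebra set) superalgebra).
        (\<forall>a\<in>{1..n}. \<forall>b\<in>{1..n}.
          h (full_class n m D (T_gen a b)) = reduced_class n m D (T_gen a b)) \<and>
        (\<forall>a\<in>{1..n}. \<forall>\<mu>\<in>{1..m}.
          h (full_class n m D (Theta_gen a \<mu>)) = reduced_class n m D (Theta_gen a \<mu>))"
      \<comment> \<open>The substitution fixes \<open>T_gen\<close> and \<open>Theta_gen\<close>, so
        the isomorphism maps their classes to the classes of the same generators.\<close>
      using h by (intro bexI[of _ h]) (simp_all add: h_class)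
  qed
qed

end
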